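(* For real $c'\ge1$, $$\mathbb{P}\!\left(Y_\infty\le\frac{c'}{2^{c'}}\right)=\frac{\mathcal N^2}{\sqrt{2\pi c'}}\,e^{c'}\,2^{-c'(c'+1)/2}\,\mathcal Q(c')\left(1+O\!\left(\frac1{c'}\right)\right),$$ where the implied constant in $O(\cdot)$ is absolute.
   Context: Let $W_1,W_2,\dots$ be i.i.d. standard exponential random variables ($\mathbb P(W_i\ge x)=e^{-x}$) and $Y_\infty:=\sum_{i\ge0}W_{i+1}/2^i$. Let $\mathcal N:=\prod_{j\ge1}\frac{2^j}{2^j-1}$. For $z\in\mathbb C\setminus\{0,-2^j:j\in\mathbb Z\}$ let $\mathcal P(z):=\sum_{j\in\mathbb Z}(-1)^j2^{-j(j+1)/2}\frac{2^jz}{2^jz+1}$, and for real $s$ let $\mathcal Q(s):=2^{s(s-1)/2}\mathcal P(2^s)$ (a positive, even, $1$-periodic function on $\mathbb R$). *)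

theory Defs
  imports "HOL-Probability.Probability"
begin

definition NN :: real where
  "NN = (\<Prod>j. (2::real) ^ (j+1) / (2 ^ (j+1) - 1))"

definition PP :: "complex \<Rightarrow> complex" where
  "PP z = (\<Sum>\<^sub>\<infinity>j::int. (-1) powi j * of_real (2 powr (- (real_of_int (j * (j + 1)) / 2)))
            * ((2 powi j) * z / ((2 powi j) * z + 1)))"

text \<open>Q(s) = 2^(s(s-1)/2) P(2^s) for real s (P is real-valued on the positive reals).\<close>
definition QQ :: "real \<Rightarrow> real" where
  "QQ s = 2 powr (s * (s - 1) / 2) * Re (PP (of_real (2 powr s)))"

definition Yinf :: "(nat \<Rightarrow> 'a \<Rightarrow> real) \<Rightarrow> 'a \<Rightarrow> real" where
  "Yinf W \<omega> = (\<Sum>i. W (i + 1) \<omega> / 2 ^ i)"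

end

theory Submission
  imports Defs
begin

text \<open>
  Put \<open>s = 2\<^bsup>c\<^esup>\<close> and \<open>L(s) = E exp (- s Y\<^sub>\<infinity>) = \<Prod>\<^bsub>i \<ge> 0\<^esub> 1 / (1 + s / 2\<^sup>i)\<close>. Under the exponentially tilted
  measure the variable \<open>s Y\<^sub>\<infinity>\<close> is a sum of independent exponentials with means
  \<open>p\<^sub>i = s / (2\<^sup>i + s)\<close>, of which about \<open>c\<close> are close to 1 and the others are geometrically small.
  Fourier inversion gives
  \<open>P (Y\<^sub>\<infinity> \<le> c / s) = L(s) e\<^bsup>c\<^esup> / (2 \<pi>) \<integral> e\<^bsup>-itc\<^esup> / ((1 - it) \<Prod>\<^sub>i (1 - it p\<^sub>i)) dt\<close>,
  and the shift to \<open>s\<close> makes \<open>t = 0\<close> an approximate saddle point: since \<open>\<Sum>\<^sub>i p\<^sub>i\<close> and \<open>\<Sum>\<^sub>i p\<^sub>i\<^sup>2\<close> are both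
  \<open>c + O(1)\<close>, the modulus of the integrand is close to \<open>e\<^bsup>-ct\<^sup>2/2\<^esup>\<close> and its phase is \<open>O(|t| + c |t|\<^sup>3)\<close>.
  In the real part the phase enters only through its square, so the integral equals \<open>sqrt (2 \<pi> / c) (1 + O(1 / c))\<close>.

  Finally \<open>\<P>\<close> is the partial fraction expansion of the reciprocal of a theta product,
  \<open>\<N>\<^sup>2 \<P>(s) / s = 1 / (\<Prod>\<^bsub>j \<ge> 0\<^esub> (1 + s / 2\<^sup>j) \<Prod>\<^bsub>j \<ge> 1\<^esub> (1 + 1 / (2\<^sup>j s)))\<close>,
  which differs from \<open>L(s)\<close> by a factor \<open>1 + O(1 / s)\<close>.
\<close>

section \<open>Fourier inversion\<close>

text \<open>The real exponential of rate \<open>Re w\<close> dominates the integrand, and the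
  antiderivative \<open>- exp (- w * v) / w\<close> vanishes at infinity. Needed both for the kernel
  in the inversion formula and for the transform of one exponential variable.\<close>

lemma has_bochner_integral_exp_complex:
  fixes w :: complex
  assumes "Re w > 0"
  shows "has_bochner_integral lborel (\<lambda>v::real. indicator {0<..} v *\<^sub>R exp (- w * of_real v)) (1 / w)"
proof -
  have w: "w \<noteq> 0"
    using assms by auto
  have int: "set_integrable lborel (einterval 0 \<infinity>) (\<lambda>v::real. exp (- w * of_real v))"
    unfolding set_integrable_def
  proof (rule Bochner_Integration.integrable_bound)
    show "integrable lborel (\<lambda>v::real. indicator {0<..} v *\<^sub>R exp (- (v * Re w)))"
      using integrable_I0i_exp_mscale[OF assms] by (simp add: set_integrable_def)
    show "AE v in lborel. norm (indicator (einterval 0 \<infinity>) v *\<^sub>R exp (- w * of_real v))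
            \<le> norm (indicator {0<..} v *\<^sub>R exp (- (v * Re w)))"
      by (auto simp: einterval_def indicator_def mult.commute)
  qed auto
  have "(LBINT v=0..\<infinity>. exp (- w * of_real v)) = 0 - (- 1 / w)"
  proof (rule interval_integral_FTC_integrable[where F = "\<lambda>v. - exp (- w * of_real v) / w"])
    fix x :: real
    show "((\<lambda>v. - exp (- w * of_real v) / w) has_vector_derivative exp (- w * of_real x)) (at x)"
      by (rule has_vector_derivative_real_field) (use w in \<open>auto intro!: derivative_eq_intros simp: field_simps\<close>)
    show "isCont (\<lambda>v. exp (- w * complex_of_real v)) x"
      by (intro continuous_intros)
  next
    show "(((\<lambda>v. - exp (- w * of_real v) / w) \<circ> real_of_ereal) \<longlongrightarrow> - 1 / w) (at_right 0)"
      unfolding zero_ereal_def ereal_tendsto_simps1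
      using w by (auto intro!: tendsto_eq_intros)
  next
    have "((\<lambda>v. norm (exp (- w * complex_of_real v))) \<longlongrightarrow> 0) at_top"
      using assms by simp real_asymp
    then have "((\<lambda>v. exp (- w * complex_of_real v)) \<longlongrightarrow> 0) at_top"
      by (rule tendsto_norm_zero_cancel)
    then show "(((\<lambda>v. - exp (- w * of_real v) / w) \<circ> real_of_ereal) \<longlongrightarrow> 0) (at_left \<infinity>)"
      unfolding ereal_tendsto_simps1 using tendsto_mult[OF _ tendsto_const[of "- 1 / w"]] by fastforce
  qed (use int in auto)
  then show ?thesis
    using int by (simp add: has_bochner_integral_iff interval_lebesgue_integral_def
        set_lebesgue_integral_def set_integrable_def einterval_eq zero_ereal_def)
qed

text \<open>For nonzero t the quotient is the integral of e^(-itx) over x in [a, b]. At t = 0 it is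
  0 by the convention on division, so the bound survives there.\<close>

lemma norm_iexp_diff_quotient_le:
  assumes "a \<le> b"
  shows "norm ((iexp (-(t * a)) - iexp (-(t * b))) / (\<i> * complex_of_real t)) \<le> b - a"
  using Levy_Inversion_aux2[of "-b" "-a" t] assms by (cases "t = 0") simp_all

text \<open>Levy's theorem gives a limit of integrals over [-T, T]. Since the kernel is bounded by b
  - a, an integrable characteristic function lets dominated convergence replace this limit by one
  integral over the line.\<close>

lemma (in real_distribution) Levy_inversion_integrable:
  assumes "a \<le> b" "measure M {a} = 0" "measure M {b} = 0"
    and int: "complex_integrable lborel (char M)"
  shows "complex_of_real (measure M {a<..b}) =
           1 / (2 * pi) * (CLBINT t. (iexp (-(t * a)) - iexp (-(t * b))) / (\<i> * t) * char M t)"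
proof (rule LIMSEQ_unique)
  let ?F = "\<lambda>t::real. (iexp (-(t * a)) - iexp (-(t * b))) / (\<i> * t)"
  show "(\<lambda>T. 1 / (2 * pi) * (CLBINT t=-real T..real T. ?F t * char M t))
          \<longlonglongrightarrow> complex_of_real (measure M {a<..b})"
    using Levy_Inversion[OF assms(1-3)] by simp
  have "(\<lambda>T::nat. CLBINT t. indicator {-real T<..<real T} t *\<^sub>R (?F t * char M t))
          \<longlonglongrightarrow> (CLBINT t. ?F t * char M t)"
  proof (rule integral_dominated_convergence)
    show "integrable lborel (\<lambda>t. (b - a) * norm (char M t))"
      using int by simp
    show "AE t in lborel. norm (indicator {-real T<..<real T} t *\<^sub>R (?F t * char M t))
            \<le> (b - a) * norm (char M t)" for T
    proof (rule AE_I2)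
      fix t :: real
      have "norm (?F t * char M t) \<le> (b - a) * norm (char M t)"
        unfolding norm_mult[of "?F t"] by (intro mult_right_mono norm_iexp_diff_quotient_le[OF \<open>a \<le> b\<close>]) auto
      then show "norm (indicator {-real T<..<real T} t *\<^sub>R (?F t * char M t)) \<le> (b - a) * norm (char M t)"
        using \<open>a \<le> b\<close> by (auto simp: indicator_def)
    qed
    show "AE t in lborel. (\<lambda>T::nat. indicator {-real T<..<real T} t *\<^sub>R (?F t * char M t))
            \<longlonglongrightarrow> ?F t * char M t"
    proof (rule AE_I2)
      fix t :: real
      obtain n :: nat where n: "\<bar>t\<bar> < real n"
        using reals_Archimedean2 by blast
      have "eventually (\<lambda>T::nat. indicator {-real T<..<real T} t *\<^sub>R (?F t * char M t) = ?F t * char M t) sequentially"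
        using eventually_ge_at_top[of n] by eventually_elim (use n in \<open>auto simp: indicator_def\<close>)
      then show "(\<lambda>T::nat. indicator {-real T<..<real T} t *\<^sub>R (?F t * char M t))
            \<longlonglongrightarrow> ?F t * char M t"
        by (rule tendsto_eventually)
    qed
  qed auto
  then have "(\<lambda>T::nat. 1 / (2 * pi) * (CLBINT t. indicator {-real T<..<real T} t *\<^sub>R (?F t * char M t)))
          \<longlonglongrightarrow> 1 / (2 * pi) * (CLBINT t. ?F t * char M t)"
    by (intro tendsto_intros) auto
  then show "(\<lambda>T. 1 / (2 * pi) * (CLBINT t=-real T..real T. ?F t * char M t))
     \<longlonglongrightarrow> 1 / (2 * pi) * (CLBINT t. ?F t * char M t)"
    by (simp add: interval_lebesgue_integral_def set_lebesgue_integral_def)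
qed

text \<open>Inversion bounds the mass of an interval around x by a multiple of its length, and the
  length can be taken arbitrarily small. This removes the side conditions on endpoints from the
  inversion formula.\<close>

lemma (in real_distribution) no_atom_if_char_integrable:
  assumes int: "complex_integrable lborel (char M)"
  shows "measure M {x} = 0"
proof -
  define K where "K = (LBINT t. norm (char M t))"
  have bnd: "measure M {x} \<le> e * K / pi" if e: "e > 0" for e
  proof -
    \<comment> \<open>There are only countably many atoms, so every nonempty open interval contains
      a point without mass.\<close>
    obtain a where a: "measure M {a} = 0" "x - e < a" "a < x"
      using open_minus_countable[OF countable_support, of "{x-e<..<x}"] e by auto
    obtain b where b: "measure M {b} = 0" "x < b" "b < x + e"
      using open_minus_countable[OF countable_support, of "{x<..<x+e}"] e by auto
    have "a \<le> b" using a b by simp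
    have "measure M {x} \<le> measure M {a<..b}"
      using a b by (intro finite_measure_mono) auto
    also have "\<dots> = norm (complex_of_real (measure M {a<..b}))"
      by simp
    also have "\<dots> = 1 / (2 * pi) * norm (CLBINT t. (iexp (-(t * a)) - iexp (-(t * b))) / (\<i> * t) * char M t)"
      unfolding Levy_inversion_integrable[OF \<open>a \<le> b\<close> a(1) b(1) int] by (simp add: norm_mult norm_divide)
    also have "\<dots> \<le> 1 / (2 * pi) * (LBINT t. (2 * e) * norm (char M t))"
    proof (intro mult_left_mono Bochner_Integration.integral_norm_bound_integral)
      show *: "norm ((iexp (-(t * a)) - iexp (-(t * b))) / (\<i> * t) * char M t) \<le> 2 * e * norm (char M t)" for t :: real
        unfolding norm_mult[of "_ / _"] using norm_iexp_diff_quotient_le[OF \<open>a \<le> b\<close>, of t] a b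
        by (intro mult_right_mono) auto
      show i2: "integrable lborel (\<lambda>t. 2 * e * norm (char M t))" using int by simp
      show "integrable lborel (\<lambda>t. (iexp (-(t * a)) - iexp (-(t * b))) / (\<i> * t) * char M t)"
        by (rule Bochner_Integration.integrable_bound[OF i2]) (use * e in auto)
    qed auto
    also have "\<dots> = e * K / pi" by (simp add: K_def)
    finally show ?thesis .
  qed
  have "((\<lambda>e. e * K / pi) \<longlongrightarrow> 0 * K / pi) (at_right 0)"
    by (intro tendsto_intros) auto
  then have "measure M {x} \<le> 0 * K / pi"
    by (rule tendsto_lowerbound) (auto simp: eventually_at_filter bnd)
  then show ?thesis using measure_nonneg[of M "{x}"] by simp
qed

text \<open>The left-hand side is the density at \<open>c\<close> of the convolution of \<open>M\<close> with the standard exponential law.\<close>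

lemma (in real_distribution) exp_convolution_inversion:
  assumes int: "complex_integrable lborel (char M)"
  shows "complex_of_real (LINT y|M. indicator {..c} y * exp (y - c)) =
           1 / (2 * pi) * (CLBINT t. iexp (-(t * c)) * char M t / (1 - \<i> * t))"
proof -
  interpret P: pair_sigma_finite lborel M ..
  let ?F = "\<lambda>v t::real. (iexp (-(t * (c - v))) - iexp (-(t * c))) / (\<i> * t)"
  let ?e = "\<lambda>v::real. indicator {0<..} v * exp (-v) :: real"
  have e_int: "integrable lborel ?e"
    using integrable_I0i_exp_mscale[of 1] by (simp add: set_integrable_def)
  have e_lint: "(LBINT v. indicator {a<..} v * exp (-v)) = exp (-a)" if "a \<ge> 0" for a :: real
  proof -
    have "(LBINT v. indicator {a<..} v * exp (-v)) = (LBINT v. indicator {a<..} (a + 1 * v) * exp (-(a + 1 * v)))"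
      using lborel_integral_real_affine[of 1 "\<lambda>v. indicator {a<..} v * exp (-v)" a] by simp
    also have "\<dots> = (LBINT v. exp (-a) * ?e v)"
      by (intro Bochner_Integration.integral_cong) (auto simp: indicator_def exp_add exp_diff exp_minus field_simps)
    also have "\<dots> = exp (-a) * (LBINT v. ?e v)"
      by simp
    also have "(LBINT v. ?e v) = 1"
      using LBINT_I0i_exp_mscale[of 1]
      by (simp add: set_lebesgue_integral_def interval_lebesgue_integral_def zero_ereal_def einterval_eq)
    finally show ?thesis by simp
  qed
  \<comment> \<open>For y <= c the weight e^(y-c) is the exponential tail, that is the integral of
    e^(-v) over v > c - y. After the exchange of integrals, y <= c and v > c - y say that y lies in
    (c-v, c], an interval to which inversion applies.\<close>
  have "(LINT y|M. indicator {..c} y * exp (y - c))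
      = (LINT y|M. (LBINT v. indicator {..c} y * (indicator {c-y<..} v * exp (-v))))"
    using e_lint by (intro Bochner_Integration.integral_cong) (auto simp: indicator_def)
  also have "\<dots> = (LBINT v. (LINT y|M. indicator {..c} y * (indicator {c-y<..} v * exp (-v))))"
  proof (rule P.Fubini_integral)
    have "measure M UNIV = 1"
      using prob_space by simp
    then have "integrable (lborel \<Otimes>\<^sub>M M) (\<lambda>(v, y). ?e v)"
      using e_int by (intro P.Fubini_integrable) auto
    then show "integrable (lborel \<Otimes>\<^sub>M M) (\<lambda>(v, y). indicator {..c} y * (indicator {c-y<..} v * exp (-v)))"
      by (rule Bochner_Integration.integrable_bound) (auto simp: indicator_def greaterThan_def)
  qed
  also have "\<dots> = (LBINT v. ?e v * measure M {c-v<..c})"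
  proof (intro Bochner_Integration.integral_cong refl)
    fix v :: real
    have "(LINT y|M. indicator {..c} y * (indicator {c-y<..} v * exp (-v)))
        = (LINT y|M. ?e v * indicator {c-v<..c} y)"
      by (intro Bochner_Integration.integral_cong) (auto simp: indicator_def)
    also have "\<dots> = ?e v * measure M {c-v<..c}"
      by simp
    finally show "(LINT y|M. indicator {..c} y * (indicator {c-y<..} v * exp (-v))) = ?e v * measure M {c-v<..c}" .
  qed
  finally have 1: "(LINT y|M. indicator {..c} y * exp (y - c)) = (LBINT v. ?e v * measure M {c-v<..c})" .
  have "complex_of_real (LBINT v. ?e v * measure M {c-v<..c})
      = (CLBINT v. of_real (?e v) * complex_of_real (measure M {c-v<..c}))"
    by (simp flip: integral_complex_of_real)
  also have "\<dots> = (CLBINT v. 1 / (2 * pi) * (CLBINT t. of_real (?e v) * (?F v t * char M t)))"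
  proof (intro Bochner_Integration.integral_cong refl)
    fix v :: real
    show "of_real (?e v) * complex_of_real (measure M {c-v<..c})
        = 1 / (2 * pi) * (CLBINT t. of_real (?e v) * (?F v t * char M t))"
    proof (cases "v > 0")
      case True
      then show ?thesis
        unfolding integral_mult_right_zero
        using Levy_inversion_integrable[of "c - v" c] no_atom_if_char_integrable[OF int] int
        by (simp del: of_real_mult of_real_diff)
    qed simp
  qed
  also have "\<dots> = 1 / (2 * pi) * (CLBINT v. CLBINT t. of_real (?e v) * (?F v t * char M t))"
    by simp
  also have "(CLBINT v. CLBINT t. of_real (?e v) * (?F v t * char M t))
           = (CLBINT t. CLBINT v. of_real (?e v) * (?F v t * char M t))"
  \<comment> \<open>The kernel is at most v, so v e^(-v) |char t| dominates. Integrability in v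
    follows from v <= 2 e^(v/2).\<close>
  proof (rule lborel_pair.Fubini_integral[symmetric])
    have "integrable lborel (\<lambda>v::real. 2 * (indicator {0<..} v * exp (- (v * (1/2)))) :: real)"
      using integrable_I0i_exp_mscale[of "1/2"] by (simp add: set_integrable_def)
    then have "integrable lborel (\<lambda>v. v * ?e v)"
    proof (rule Bochner_Integration.integrable_bound)
      have "v * exp (-v) \<le> 2 * exp (- (v * (1/2)))" for v :: real
      proof -
        have "v \<le> 2 * exp (v / 2)"
          using exp_ge_add_one_self[of "v/2"] by argo
        then have "v * exp (-v) \<le> 2 * exp (v / 2) * exp (-v)"
          by (intro mult_right_mono) auto
        then show ?thesis by (simp add: mult.assoc flip: exp_add)
      qed
      then show "AE v in lborel. norm (v * ?e v) \<le> norm (2 * (indicator {0<..} v * exp (- (v * (1/2)))) :: real)"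
        by (auto simp: indicator_def abs_mult)
    qed auto
    moreover have "(\<lambda>v. \<bar>v\<bar> * ?e v) = (\<lambda>v. v * ?e v)"
      by (auto simp: indicator_def)
    ultimately have "integrable (lborel \<Otimes>\<^sub>M lborel) (\<lambda>(v, t). v * ?e v * norm (char M t))"
      using int by (intro lborel_pair.Fubini_integrable) (auto simp: abs_mult split_beta)
    then show "integrable (lborel \<Otimes>\<^sub>M lborel) (\<lambda>(v, t). of_real (?e v) * (?F v t * char M t))"
    proof (rule Bochner_Integration.integrable_bound)
      have "norm (of_real (?e v) * (?F v t * char M t)) \<le> norm (v * ?e v * norm (char M t))" for v t
      proof (cases "v > 0")
        case True
        then have "norm (?F v t) \<le> v"
          using norm_iexp_diff_quotient_le[of "c - v" c t] by simp
        then have "\<bar>?e v\<bar> * (norm (?F v t) * norm (char M t)) \<le> \<bar>?e v\<bar> * (v * norm (char M t))"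
          by (intro mult_left_mono mult_right_mono) auto
        also have "\<dots> = norm (v * ?e v * norm (char M t))"
          using True by (simp add: abs_mult)
        finally show ?thesis
          by (simp only: norm_mult norm_of_real)
      qed simp
      then show "AE x in lborel \<Otimes>\<^sub>M lborel. norm (case x of (v, t) \<Rightarrow> of_real (?e v) * (?F v t * char M t))
               \<le> norm (case x of (v, t) \<Rightarrow> v * ?e v * norm (char M t))"
        by (intro AE_I2) (auto simp only: split_beta)
    qed auto
  qed
  also have "\<dots> = (CLBINT t. iexp (-(t * c)) * char M t / (1 - \<i> * t))"
  \<comment> \<open>For nonzero t the v-integral is a difference of two exponential integrals, of
    rates 1 - it and 1, and (1/(1-it) - 1)/(it) = 1/(1-it). At t = 0 the left side is 0 by the
    convention on division, hence equality only almost everywhere.\<close>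
  proof (rule Bochner_Integration.integral_cong_AE)
    have "(CLBINT v. of_real (?e v) * (?F v t * char M t)) = iexp (-(t * c)) * char M t / (1 - \<i> * t)"
      if t: "t \<noteq> 0" for t
    proof -
      have ne: "1 - \<i> * complex_of_real t \<noteq> 0"
        by (auto simp: complex_eq_iff)
      let ?g = "\<lambda>w v. indicator {0<..} v *\<^sub>R exp (- w * complex_of_real v)"
      have h1: "has_bochner_integral lborel (\<lambda>v. iexp (-(t * c)) * char M t / (\<i> * t) * (?g (1 - \<i> * t) v - ?g 1 v))
              (iexp (-(t * c)) * char M t / (\<i> * t) * (1 / (1 - \<i> * t) - 1 / 1))"
        by (intro has_bochner_integral_mult_right has_bochner_integral_diff has_bochner_integral_exp_complex) auto
      have h2: "iexp (-(t * c)) * char M t / (\<i> * t) * (?g (1 - \<i> * t) v - ?g 1 v) = of_real (?e v) * (?F v t * char M t)" for v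
        using t by (auto simp: indicator_def field_simps simp flip: exp_add exp_minus exp_of_real)
      have h3: "iexp (-(t * c)) * char M t / (\<i> * t) * (1 / (1 - \<i> * t) - 1 / 1) = iexp (-(t * c)) * char M t / (1 - \<i> * t)"
        using t ne by (simp add: divide_simps)
      from h1 show ?thesis
        unfolding h2 h3 by (rule has_bochner_integral_integral_eq)
    qed
    then show "AE t in lborel. (CLBINT v. of_real (?e v) * (?F v t * char M t)) = iexp (-(t * c)) * char M t / (1 - \<i> * t)"
      by (intro AE_I[of _ _ "{0}"]) auto
  qed auto
  finally show ?thesis unfolding 1 .
qed

section \<open>The theta product\<close>

text \<open>Lagrange interpolation: X^m has degree below the number of nodes, so it equals its
  interpolation polynomial \<open>p\<close> at the points \<open>x i\<close>. Dividing by the nodal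
  polynomial gives the expansion.\<close>

lemma power_over_prod_partial_fractions:
  fixes x :: "'i \<Rightarrow> 'a :: field"
  assumes fin: "finite I" and inj: "inj_on x I" and m: "m < card I" and z: "z \<notin> x ` I"
  shows "z ^ m / (\<Prod>i\<in>I. z - x i) = (\<Sum>i\<in>I. x i ^ m / (\<Prod>j\<in>I-{i}. x i - x j) / (z - x i))"
proof -
  define p where "p = (\<Sum>i\<in>I. smult (x i ^ m / (\<Prod>j\<in>I-{i}. x i - x j)) (\<Prod>j\<in>I-{i}. [:- x j, 1:]))"
  have "p = monom 1 m"
  proof (rule poly_eqI_degree)
    fix y assume "y \<in> x ` I"
    then obtain k where k: "k \<in> I" "y = x k" by auto
    have nz: "(\<Prod>j\<in>I-{k}. x k - x j) \<noteq> 0"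
      using fin inj k by (auto dest: inj_onD)
    have "poly p y = (\<Sum>i\<in>I. x i ^ m / (\<Prod>j\<in>I-{i}. x i - x j) * (\<Prod>j\<in>I-{i}. x k - x j))"
      by (simp add: p_def poly_sum poly_prod k)
    also have "\<dots> = (\<Sum>i\<in>I. if i = k then x k ^ m else 0)"
      using fin k nz by (intro sum.cong) auto
    also have "\<dots> = poly (monom 1 m) y"
      using fin k by (simp add: poly_monom)
    finally show "poly p y = poly (monom 1 m) y" .
  next
    have c: "card (x ` I) = card I"
      using inj by (rule card_image)
    show "card (x ` I) > degree (monom (1::'a) m)"
      unfolding c using m by (simp add: degree_monom_eq)
    have "degree p \<le> card I - 1"
      unfolding p_def
    proof (intro degree_sum_le fin order.trans[OF degree_smult_le])
      fix i assume i: "i \<in> I"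
      have "degree (\<Prod>j\<in>I-{i}. [:- x j, 1:]) \<le> (\<Sum>j\<in>I-{i}. degree [:- x j, 1:])"
        using degree_prod_sum_le[of "I - {i}" "\<lambda>j. [:- x j, 1:]"] fin by (simp add: o_def)
      also have "\<dots> = card I - 1"
        using fin i by simp
      finally show "degree (\<Prod>j\<in>I-{i}. [:- x j, 1:]) \<le> card I - 1" .
    qed
    then show "card (x ` I) > degree p"
      unfolding c using m by linarith
  qed
  then have "z ^ m = poly p z"
    by (simp add: poly_monom)
  also have "\<dots> = (\<Sum>i\<in>I. x i ^ m / (\<Prod>j\<in>I-{i}. x i - x j) * (\<Prod>j\<in>I-{i}. z - x j))"
    by (simp add: p_def poly_sum poly_prod)
  finally have "z ^ m / (\<Prod>i\<in>I. z - x i) =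
      (\<Sum>i\<in>I. x i ^ m / (\<Prod>j\<in>I-{i}. x i - x j) * (\<Prod>j\<in>I-{i}. z - x j) / (\<Prod>i\<in>I. z - x i))"
    by (simp add: sum_divide_distrib)
  also have "\<dots> = (\<Sum>i\<in>I. x i ^ m / (\<Prod>j\<in>I-{i}. x i - x j) / (z - x i))"
  proof (intro sum.cong refl)
    fix i assume i: "i \<in> I"
    have "(\<Prod>j\<in>I-{i}. z - x j) \<noteq> 0"
      using fin z by auto
    then show "x i ^ m / (\<Prod>j\<in>I-{i}. x i - x j) * (\<Prod>j\<in>I-{i}. z - x j) / (\<Prod>i\<in>I. z - x i)
      = x i ^ m / (\<Prod>j\<in>I-{i}. x i - x j) / (z - x i)"
      using fin i by (subst prod.remove[of I i]) auto
  qed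
  finally show ?thesis .
qed

text \<open>The finite q-Pochhammer symbol (q; q)_m at q = 1/2; \<open>NN\<close> is the reciprocal
  of its limit.\<close>

definition half_qpoch :: "nat \<Rightarrow> real" where
  "half_qpoch m = (\<Prod>i=1..m. 1 - 1 / 2 ^ i)"

lemma half_qpoch_pos: "half_qpoch m > 0"
  unfolding half_qpoch_def by (intro prod_pos) auto

lemma half_qpoch_conv_NN:
  "inverse (half_qpoch m) = (\<Prod>j<m. (2::real) ^ (j+1) / (2 ^ (j+1) - 1))"
proof -
  have "half_qpoch m = (\<Prod>j<m. 1 - 1 / 2 ^ (j+1))"
    unfolding half_qpoch_def by (rule prod.reindex_bij_witness[of _ Suc "\<lambda>i. i - 1"]) auto
  also have "inverse \<dots> = (\<Prod>j<m. inverse (1 - 1 / 2 ^ (j+1)))"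
    by (simp add: prod_inversef[symmetric])
  also have "\<dots> = (\<Prod>j<m. (2::real) ^ (j+1) / (2 ^ (j+1) - 1))"
    by (intro prod.cong) (auto simp: field_simps)
  finally show ?thesis .
qed

lemma tendsto_inverse_half_qpoch: "(\<lambda>m. inverse (half_qpoch m)) \<longlonglongrightarrow> NN"
proof -
  have eq: "(2::real) ^ (j+1) / (2 ^ (j+1) - 1) = 1 + 1 / (2 ^ (j+1) - 1)" for j :: nat
  proof -
    have "(2::real) ^ (j+1) - 1 > 0"
      by (metis add_gr_0 less_numeral_extra(1) one_less_numeral_iff one_less_power semiring_norm(76) diff_gt_0_iff_gt)
    then show ?thesis by (simp add: field_simps)
  qed
  have "summable (\<lambda>j. norm (1 / ((2::real) ^ (j+1) - 1)))"
  proof (rule summable_comparison_test_ev)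
    show "summable (\<lambda>j. (1/2::real) ^ j)" by (rule summable_geometric) auto
    have "1 / ((2::real) ^ (j+1) - 1) \<le> (1/2) ^ j" for j
      using one_le_power[of "2::real" j] by (simp add: divide_simps power_divide)
    then show "\<forall>\<^sub>F j in sequentially. norm (norm (1 / ((2::real) ^ (j+1) - 1))) \<le> (1/2) ^ j"
      by (intro always_eventually allI) (simp add: abs_of_pos one_less_power del: power_Suc)
  qed
  then have "convergent_prod (\<lambda>j. 1 + 1 / ((2::real) ^ (j+1) - 1))"
    by (intro abs_convergent_prod_imp_convergent_prod summable_imp_abs_convergent_prod) simp_all
  then have "(\<lambda>n. \<Prod>j\<le>n. (2::real) ^ (j+1) / (2 ^ (j+1) - 1)) \<longlonglongrightarrow> NN"
    unfolding NN_def eq by (rule convergent_prod_LIMSEQ)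
  then have "(\<lambda>n. \<Prod>j<Suc n. (2::real) ^ (j+1) / (2 ^ (j+1) - 1)) \<longlonglongrightarrow> NN"
    by (simp only: lessThan_Suc_atMost)
  then show ?thesis
    unfolding half_qpoch_conv_NN by (rule filterlim_sequentially_Suc[THEN iffD1])
qed

text \<open>The reciprocals increase to \<open>NN\<close> because every factor of
  \<open>half_qpoch\<close> is below 1. The bound is uniform in m, as dominated convergence of the
  truncated theta expansion requires.\<close>

lemma inverse_half_qpoch_le_NN: "inverse (half_qpoch m) \<le> NN"
proof (rule incseq_le[OF _ tendsto_inverse_half_qpoch])
  show "incseq (\<lambda>m. inverse (half_qpoch m))"
  proof (rule incseq_SucI)
    fix m
    have "half_qpoch (Suc m) = half_qpoch m * (1 - 1 / 2 ^ Suc m)"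
      by (simp add: half_qpoch_def)
    also have "\<dots> \<le> half_qpoch m"
      using half_qpoch_pos[of m] by (intro mult_left_le) auto
    finally have "half_qpoch (Suc m) \<le> half_qpoch m" .
    then show "inverse (half_qpoch m) \<le> inverse (half_qpoch (Suc m))"
      using half_qpoch_pos by (intro le_imp_inverse_le) auto
  qed
qed

lemma NN_pos: "NN > 0"
  using inverse_half_qpoch_le_NN[of 0] by (simp add: half_qpoch_def)

text \<open>The residues of \<open>2\<^bsup>n(n+1)/2\<^esup> z\<^bsup>n\<^esup> / \<Prod>\<^bsub>|k| \<le> n\<^esub> (z + 2\<^sup>k)\<close>.\<close>

lemma theta_coefficient:
  fixes k :: int and n :: nat
  assumes k: "\<bar>k\<bar> \<le> int n"
  shows "2 powr (real (n * (n + 1)) / 2) * (- (2 powi k)) ^ n / (\<Prod>l\<in>{-int n..int n}-{k}. (- (2 powi k)) - (- (2 powi l)))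
       = (-1) powi k * 2 powr (- (of_int (k * (k - 1)) / 2))
           / (half_qpoch (nat (int n - k)) * half_qpoch (nat (int n + k)))"
proof -
  define a b where "a = nat (int n - k)" and "b = nat (int n + k)"
  have ab: "int a = int n - k" "int b = int n + k" "real a = real n - of_int k" "real b = real n + of_int k"
    using k by (auto simp: a_def b_def)
  have powi2: "(2::real) powi l = 2 powr of_int l" for l
    by (simp add: powr_real_of_int')
  have pw_nat: "(2::real) ^ nat l = 2 powr of_int l" if "l \<ge> 0" for l
    using that by (simp flip: powr_realpow)
  have "(\<Prod>l\<in>{-int n..int n}-{k}. (- (2 powi k)) - (- (2 powi l)))
      = (\<Prod>l\<in>{k+1..int n} \<union> {-int n..k-1}. 2 powi l - 2 powi k :: real)"
    using k by (intro prod.cong) auto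
  also have "\<dots> = (\<Prod>l\<in>{k+1..int n}. 2 powi l - 2 powi k :: real) * (\<Prod>l\<in>{-int n..k-1}. 2 powi l - 2 powi k)"
    by (rule prod.union_disjoint) auto
  \<comment> \<open>In every factor the larger of the two powers is pulled out: 2^(k+i) for l = k +
    i above k, and -2^k for l = k - i below k. What remains on each side is a q-Pochhammer
    symbol.\<close>
  also have "(\<Prod>l\<in>{k+1..int n}. 2 powi l - 2 powi k :: real) = (\<Prod>i=1..a. 2 powi (k + int i) * (1 - 1 / 2 ^ i))"
    by (rule prod.reindex_bij_witness[of _ "\<lambda>i. k + int i" "\<lambda>l. nat (l - k)"])
       (use ab in \<open>auto simp: pw_nat powi2 field_simps simp flip: powr_add\<close>)
  also have "\<dots> = (\<Prod>i=1..a. 2 powi (k + int i)) * half_qpoch a"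
    by (simp add: prod.distrib half_qpoch_def)
  also have "(\<Prod>i=1..a. 2 powi (k + int i)) = (2::real) powr (of_int k * a + real (a * (a + 1)) / 2)"
    unfolding powi2 by (induction a) (auto simp: field_simps simp flip: powr_add)
  also have "(\<Prod>l\<in>{-int n..k-1}. 2 powi l - 2 powi k :: real) = (\<Prod>i=1..b. - (2 powi k) * (1 - 1 / 2 ^ i))"
    by (rule prod.reindex_bij_witness[of _ "\<lambda>i. k - int i" "\<lambda>l. nat (k - l)"])
       (use ab in \<open>auto simp: pw_nat powi2 field_simps simp flip: powr_add powr_diff\<close>)
  also have "\<dots> = (- (2 powi k)) ^ b * half_qpoch b"
    unfolding prod.distrib half_qpoch_def by simp
  finally have prod_eq: "(\<Prod>l\<in>{-int n..int n}-{k}. (- (2 powi k)) - (- (2 powi l)))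
     = 2 powr (of_int k * a + real (a * (a + 1)) / 2) * half_qpoch a * ((- (2 powi k)) ^ b * half_qpoch b :: real)" .
  have pw: "(- (2 powi k)) ^ j = (-1) ^ j * 2 powr (of_int k * real j :: real)" for j :: nat
    unfolding powi2 by (subst power_minus) (simp add: powr_powr flip: powr_realpow)
  have sgn: "(-1::real) ^ n / (-1) ^ b = (-1) powi k"
  proof -
    have "(-1::real) ^ b = (-1) powi (int n + k)"
      using ab(2) by (metis power_int_of_nat)
    also have "\<dots> = (-1) ^ n * (-1) powi k"
      by (simp add: power_int_add)
    finally show ?thesis
      by (cases "even n"; cases "even k") (auto simp: power_int_minus_left)
  qed
  have "2 powr (real (n * (n + 1)) / 2) * (- (2 powi k)) ^ n / (\<Prod>l\<in>{-int n..int n}-{k}. (- (2 powi k)) - (- (2 powi l)))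
     = ((-1) ^ n / (-1) ^ b) * (2 powr (real (n * (n + 1)) / 2) * 2 powr (of_int k * real n)
         / (2 powr (of_int k * a + real (a * (a + 1)) / 2) * 2 powr (of_int k * real b))) / (half_qpoch a * half_qpoch b)"
    unfolding prod_eq pw by (simp add: field_simps)
  also have "2 powr (real (n * (n + 1)) / 2) * 2 powr (of_int k * real n)
         / (2 powr (of_int k * a + real (a * (a + 1)) / 2) * 2 powr (of_int k * real b))
       = 2 powr (- (of_int (k * (k - 1)) / 2) :: real)"
    \<comment> \<open>With a = n - k and b = n + k the dependence on n cancels: n(n+1)/2 - a(a+1)/2
      = nk - k(k-1)/2, while kn - ka - kb contributes kn - 2kn = -nk, the term ka + kb being
      2kn.\<close>
    unfolding powr_add[symmetric] powr_diff[symmetric]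
    by (rule arg_cong[where f = "(powr) 2"]) (simp add: ab algebra_simps power2_eq_square divide_simps)
  finally show ?thesis
    unfolding sgn unfolding a_def b_def .
qed

text \<open>In the product of z + 2^k over |k| <= n, the k >= 0 give powers of 2 times the factors 1
  + z/2^k, and each k < 0 gives z times 1 + 2^k/z. Hence the left side is 2^(n(n+1)/2) z^n over a
  polynomial with 2n+1 simple roots, and n < 2n+1 permits partial fractions.\<close>

lemma theta_finite_partial_fractions:
  fixes z :: real
  assumes z: "z > 0"
  shows "(\<Prod>j\<le>n. 1 / (1 + z / 2 ^ j)) * (\<Prod>j<n. 1 / (1 + 1 / (2 ^ (j+1) * z))) =
    (\<Sum>k=-int n..int n. (-1) powi k * 2 powr (- (of_int (k * (k - 1)) / 2)) / (z + 2 powi k)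
           / (half_qpoch (nat (int n - k)) * half_qpoch (nat (int n + k))))"
proof -
  let ?x = "\<lambda>k::int. - (2 powi k) :: real"
  let ?P = "2 powr (real (n * (n + 1)) / 2) :: real"
  have "(\<Prod>k\<in>{-int n..int n}. z - ?x k) = (\<Prod>k\<in>{0..int n} \<union> {-int n..-1}. z + 2 powi k)"
    by (intro prod.cong) auto
  also have "\<dots> = (\<Prod>k\<in>{0..int n}. z + 2 powi k) * (\<Prod>k\<in>{-int n..-1}. z + 2 powi k)"
    by (rule prod.union_disjoint) auto
  also have "(\<Prod>k\<in>{0..int n}. z + 2 powi k) = (\<Prod>j\<le>n. 2 ^ j * (1 + z / 2 ^ j))"
    by (rule prod.reindex_bij_witness[of _ int nat]) (auto simp: field_simps power_int_def)
  also have "\<dots> = ?P * (\<Prod>j\<le>n. 1 + z / 2 ^ j)"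
  proof -
    have "(\<Prod>j\<le>n. 2 ^ j) = ?P"
      by (induction n) (auto simp: field_simps simp flip: powr_add powr_realpow)
    then show ?thesis by (simp add: prod.distrib)
  qed
  also have "(\<Prod>k\<in>{-int n..-1}. z + 2 powi k) = (\<Prod>j<n. z * (1 + 1 / (2 ^ (j+1) * z)))"
    by (rule prod.reindex_bij_witness[of _ "\<lambda>j. - int (j + 1)" "\<lambda>k. nat (- k - 1)"])
       (use z in \<open>auto simp: field_simps power_int_minus nat_diff_distrib simp flip: power_int_of_nat\<close>)
  also have "\<dots> = z ^ n * (\<Prod>j<n. 1 + 1 / (2 ^ (j+1) * z))"
    by (simp add: prod.distrib)
  finally have prod_eq: "(\<Prod>k\<in>{-int n..int n}. z - ?x k) = ?P * (\<Prod>j\<le>n. 1 + z / 2 ^ j) * (z ^ n * (\<Prod>j<n. 1 + 1 / (2 ^ (j+1) * z)))" .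
  have "(\<Prod>j\<le>n. 1 / (1 + z / 2 ^ j)) * (\<Prod>j<n. 1 / (1 + 1 / (2 ^ (j+1) * z))) = ?P * (z ^ n / (\<Prod>k\<in>{-int n..int n}. z - ?x k))"
    unfolding prod_eq using z by (simp add: prod_dividef)
  also have "\<dots> = ?P * (\<Sum>k\<in>{-int n..int n}. ?x k ^ n / (\<Prod>l\<in>{-int n..int n}-{k}. ?x k - ?x l) / (z - ?x k))"
  proof (subst power_over_prod_partial_fractions)
    show "inj_on ?x {-int n..int n}"
      by (auto simp: inj_on_def powr_inj simp flip: powr_real_of_int')
    show "z \<notin> ?x ` {-int n..int n}"
    proof
      assume "z \<in> ?x ` {-int n..int n}"
      then obtain k where "z = ?x k" by auto
      moreover have "(2::real) powi k > 0" by simp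
      ultimately show False using z by linarith
    qed
  qed auto
  also have "\<dots> = (\<Sum>k=-int n..int n. ?P * ?x k ^ n / (\<Prod>l\<in>{-int n..int n}-{k}. ?x k - ?x l) / (z - ?x k))"
    by (simp add: sum_distrib_left)
  also have "\<dots> = (\<Sum>k=-int n..int n. (-1) powi k * 2 powr (- (of_int (k * (k - 1)) / 2)) / (z + 2 powi k)
           / (half_qpoch (nat (int n - k)) * half_qpoch (nat (int n + k))))"
    by (intro sum.cong refl, subst theta_coefficient) auto
  finally show ?thesis .
qed

text \<open>Gaussian decay is weakened to geometric decay through k(k+1) >= 0 for k <= 0 and
  (k-1)(k-2) >= 0 for k > 0, valid for integers.\<close>

lemma two_powr_triangle_le:
  fixes k :: int
  shows "2 powr (- (of_int (k * (k - 1)) / 2)) \<le> 4 * (1/2 :: real) ^ nat \<bar>k\<bar>"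
proof -
  have "2 * \<bar>k\<bar> \<le> k * (k - 1) + 4"
  proof (cases "k \<le> 0")
    case True
    then have "0 \<le> (-k) * (-k - 1)"
      by (cases "k = 0") (simp, intro mult_nonneg_nonneg, auto)
    then show ?thesis using True by (simp add: algebra_simps)
  next
    case False
    have "0 \<le> (k - 1) * (k - 2)"
      using False by (cases "k = 1") auto
    then show ?thesis using False by (simp add: algebra_simps)
  qed
  then have "real_of_int (2 * \<bar>k\<bar>) \<le> of_int (k * (k - 1) + 4)"
    by (rule of_int_le_iff[THEN iffD2])
  then have "- (of_int (k * (k - 1)) / 2) \<le> 2 - real (nat \<bar>k\<bar>)"
    by simp
  then have "2 powr (- (of_int (k * (k - 1)) / 2)) \<le> 2 powr (2 - real (nat \<bar>k\<bar>))"
    by (intro powr_mono) auto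
  also have "\<dots> = 4 * (1/2 :: real) ^ nat \<bar>k\<bar>"
    by (simp only: powr_diff powr_realpow zero_less_numeral) (simp add: power_divide)
  finally show ?thesis .
qed

lemma half_power_summable_on_int: "(\<lambda>k::int. (1/2 :: real) ^ nat \<bar>k\<bar>) summable_on UNIV"
proof -
  have nat: "(\<lambda>n::nat. (1/2 :: real) ^ n) summable_on UNIV"
    by (rule norm_summable_imp_summable_on) (auto intro!: summable_geometric)
  have "(\<lambda>k::int. (1/2 :: real) ^ nat \<bar>k\<bar>) summable_on range int"
    using nat by (subst summable_on_reindex) (auto simp: o_def)
  moreover have "(\<lambda>k::int. (1/2 :: real) ^ nat \<bar>k\<bar>) summable_on range (\<lambda>n. - int n)"
    using nat by (subst summable_on_reindex) (auto simp: o_def inj_on_def)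
  moreover have "UNIV = range int \<union> range (\<lambda>n. - int n)"
    by (auto simp: image_iff) (metis int_cases2)
  ultimately show ?thesis
    by (metis summable_on_union)
qed

text \<open>Dominated convergence for sums over the integers, written as integrals over
  \<open>count_space\<close>: for fixed k both Pochhammer symbols converge, which produces the two
  factors \<open>NN\<close>, and \<open>w\<close> is a summable majorant independent of n.\<close>

lemma theta_product_tendsto:
  fixes z :: real
  assumes z: "z > 0"
  shows "(\<lambda>n. (\<Prod>j\<le>n. 1 / (1 + z / 2 ^ j)) * (\<Prod>j<n. 1 / (1 + 1 / (2 ^ (j+1) * z)))) \<longlonglongrightarrow>
           NN\<^sup>2 * (Re (PP (of_real z)) / z)"
proof -
  define f where "f k = (-1) powi k * 2 powr (- (of_int (k * (k - 1)) / 2)) / (z + 2 powi k)" for k :: int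
  define D where "D n k = half_qpoch (nat (int n - k)) * half_qpoch (nat (int n + k))" for n :: nat and k
  define w where "w k = NN\<^sup>2 * (4 / z * (1/2) ^ nat \<bar>k\<bar>)" for k :: int
  have f_le: "\<bar>f k\<bar> \<le> 4 / z * (1/2) ^ nat \<bar>k\<bar>" for k
  proof -
    have "z + 2 powi k \<ge> z" "z + 2 powi k > 0"
      using z by (auto intro: add_pos_pos)
    then have "\<bar>f k\<bar> \<le> 2 powr (- (of_int (k * (k - 1)) / 2)) / z"
      using z by (auto simp: f_def abs_mult power_int_abs[symmetric] intro!: divide_left_mono mult_pos_pos)
    also have "\<dots> \<le> (4 * (1/2) ^ nat \<bar>k\<bar>) / z"
      using z by (intro divide_right_mono two_powr_triangle_le) auto
    finally show ?thesis by simp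
  qed
  have w: "Infinite_Set_Sum.abs_summable_on w UNIV"
    unfolding w_def
    by (intro abs_summable_on_cmult_right)
       (use half_power_summable_on_int in \<open>simp flip: abs_summable_equivalent\<close>)
  have f: "Infinite_Set_Sum.abs_summable_on f UNIV"
  proof (rule abs_summable_on_comparison_test')
    show "Infinite_Set_Sum.abs_summable_on (\<lambda>k::int. 4 / z * (1/2) ^ nat \<bar>k\<bar>) UNIV"
      by (intro abs_summable_on_cmult_right)
         (use half_power_summable_on_int in \<open>simp flip: abs_summable_equivalent\<close>)
  qed (use f_le in auto)
  have D_lim: "(\<lambda>n. f k / D n k) \<longlonglongrightarrow> NN\<^sup>2 * f k" for k
  proof -
    have 1: "filterlim (\<lambda>n. nat (int n + l)) at_top sequentially" for l
      unfolding filterlim_at_top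
    proof
      fix Z
      show "eventually (\<lambda>n. Z \<le> nat (int n + l)) sequentially"
        using eventually_ge_at_top[of "Z + nat \<bar>l\<bar>"] by eventually_elim linarith
    qed
    have "(\<lambda>n. f k * (inverse (half_qpoch (nat (int n + - k))) * inverse (half_qpoch (nat (int n + k))))) \<longlonglongrightarrow> f k * (NN * NN)"
      by (intro tendsto_intros filterlim_compose[OF tendsto_inverse_half_qpoch 1])
    then show ?thesis
      by (simp add: D_def field_simps power2_eq_square)
  qed
  have D_le: "\<bar>f k / D n k\<bar> \<le> w k" for n k
  proof -
    have "inverse (D n k) \<le> NN * NN"
      unfolding D_def inverse_mult_distrib using half_qpoch_pos NN_pos
      by (intro mult_mono inverse_half_qpoch_le_NN) (auto intro: less_imp_le)
    moreover have "D n k > 0"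
      unfolding D_def by (intro mult_pos_pos half_qpoch_pos)
    ultimately show ?thesis
      using f_le[of k] mult_mono[of "inverse (D n k)" "NN * NN" "\<bar>f k\<bar>" "4 / z * (1/2) ^ nat \<bar>k\<bar>"] NN_pos
      by (simp add: w_def power2_eq_square field_simps)
  qed
  have "(\<lambda>n. LINT k|count_space UNIV. indicator {-int n..int n} k *\<^sub>R (f k / D n k))
      \<longlonglongrightarrow> (LINT k|count_space UNIV. NN\<^sup>2 * f k)"
  proof (rule integral_dominated_convergence)
    show "integrable (count_space UNIV) w"
      using w by (simp add: abs_summable_on_def)
    show "AE k in count_space UNIV. norm (indicator {-int n..int n} k *\<^sub>R (f k / D n k)) \<le> w k" for n
      using D_le order.trans[OF abs_ge_zero D_le] by (intro AE_I2) (auto simp: indicator_def)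
    show "AE k in count_space UNIV. (\<lambda>n. indicator {-int n..int n} k *\<^sub>R (f k / D n k)) \<longlonglongrightarrow> NN\<^sup>2 * f k"
    proof (rule AE_I2)
      fix k :: int
      have "eventually (\<lambda>n. f k / D n k = indicator {-int n..int n} k *\<^sub>R (f k / D n k)) sequentially"
        using eventually_ge_at_top[of "nat \<bar>k\<bar>"] by eventually_elim (auto simp: indicator_def)
      then show "(\<lambda>n. indicator {-int n..int n} k *\<^sub>R (f k / D n k)) \<longlonglongrightarrow> NN\<^sup>2 * f k"
        by (rule Lim_transform_eventually[OF D_lim])
    qed
  qed auto
  also have "(\<lambda>n. LINT k|count_space UNIV. indicator {-int n..int n} k *\<^sub>R (f k / D n k))
      = (\<lambda>n. \<Sum>k=-int n..int n. f k / D n k)"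
    by (auto simp flip: infsetsum_finite simp: infsetsum_altdef set_lebesgue_integral_def)
  also have "\<dots> = (\<lambda>n. (\<Prod>j\<le>n. 1 / (1 + z / 2 ^ j)) * (\<Prod>j<n. 1 / (1 + 1 / (2 ^ (j+1) * z))))"
    unfolding theta_finite_partial_fractions[OF z] f_def D_def ..
  also have "(LINT k|count_space UNIV. NN\<^sup>2 * f k) = NN\<^sup>2 * infsetsum f UNIV"
    by (simp add: infsetsum_def)
  also have "infsetsum f UNIV = infsum f UNIV"
    by (rule infsetsum_infsum[OF f])
  also have "infsum f UNIV = Re (PP (of_real z)) / z"
  proof -
    \<comment> \<open>The index is reflected, k = -j: then k(k-1) = j(j+1) and 2^j z / (2^j z + 1) =
      z / (z + 2^k).\<close>
    have "PP (of_real z) = (\<Sum>\<^sub>\<infinity>j::int. of_real (z * f (- j)))"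
      unfolding PP_def
    proof (intro infsum_cong)
      fix j :: int
      have "2 powi j * z / (2 powi j * z + 1) = z / (z + 2 powi (- j))"
        using z by (simp add: power_int_minus field_simps)
      moreover have "(-1 :: real) powi (- j) = (-1) powi j"
        by (simp add: power_int_minus_left)
      ultimately have "z * f (- j) = (-1) powi j * 2 powr (- (real_of_int (j * (j + 1)) / 2)) * (2 powi j * z / (2 powi j * z + 1))"
        by (simp add: f_def algebra_simps)
      then show "(-1) powi j * of_real (2 powr (- (real_of_int (j * (j + 1)) / 2))) * (2 powi j * of_real z / (2 powi j * of_real z + 1))
              = complex_of_real (z * f (- j))"
        by (simp only: of_real_mult of_real_divide of_real_add of_real_power_int of_real_1 of_real_minus of_real_numeral)
    qed
    also have "\<dots> = of_real (\<Sum>\<^sub>\<infinity>j::int. z * f (- j))"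
    proof (intro infsumI has_sum_of_real has_sum_infsum summable_on_cmult_right)
      have "f summable_on UNIV"
        using f unfolding abs_summable_equivalent[symmetric] by (rule abs_summable_summable)
      then show "(\<lambda>j. f (- j)) summable_on UNIV"
        using summable_on_reindex_bij_betw[OF bij_uminus, of f] by simp
    qed
    also have "(\<Sum>\<^sub>\<infinity>j::int. z * f (- j)) = z * (\<Sum>\<^sub>\<infinity>j::int. f (- j))"
      by (rule infsum_cmult_right')
    also have "(\<Sum>\<^sub>\<infinity>j::int. f (- j)) = infsum f UNIV"
      by (rule infsum_reindex_bij_betw) (rule bij_uminus)
    finally show ?thesis using z by simp
  qed
  finally show ?thesis .
qed

section \<open>The saddle point integral\<close>

text \<open>In logarithmic form the difference of the two sides has derivative a/(1+x) - a/(1+ax) >=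
  0. It turns a product of about c factors into a polynomial bound in c t^2, and also yields 2^c >=
  1 + c.\<close>

lemma powr_Bernoulli:
  fixes x a :: real
  assumes "x \<ge> 0" "a \<ge> 1"
  shows "1 + a * x \<le> (1 + x) powr a"
proof -
  have "ln (1 + a * x) \<le> a * ln (1 + x)"
  proof -
    let ?f = "\<lambda>x. a * ln (1 + x) - ln (1 + a * x)"
    have "?f 0 \<le> ?f x"
    proof (rule DERIV_nonneg_imp_nondecreasing[OF assms(1)])
      fix y :: real assume y: "0 \<le> y" "y \<le> x"
      have "(?f has_real_derivative a / (1 + y) - a / (1 + a * y)) (at y)"
        using y assms by (auto intro!: derivative_eq_intros simp: add_pos_nonneg)
      moreover have "a / (1 + a * y) \<le> a / (1 + y)"
        using y assms by (intro divide_left_mono) (auto simp: add_pos_nonneg mult_le_cancel_right1)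
      ultimately show "\<exists>d. (?f has_real_derivative d) (at y) \<and> 0 \<le> d"
        by (intro exI[of _ "a / (1 + y) - a / (1 + a * y)"]) auto
    qed
    then show ?thesis by simp
  qed
  then have "exp (ln (1 + a * x)) \<le> exp (a * ln (1 + x))"
    by simp
  then show ?thesis
    using assms by (simp add: powr_def add_pos_nonneg)
qed

lemma ln_one_plus_ge_quadratic:
  fixes u :: real
  assumes "u \<ge> 0"
  shows "u - u\<^sup>2 / 2 \<le> ln (1 + u)"
proof -
  let ?f = "\<lambda>u. ln (1 + u) - u + u\<^sup>2 / 2"
  have "?f 0 \<le> ?f u"
  proof (rule DERIV_nonneg_imp_nondecreasing[OF assms])
    fix y :: real assume y: "0 \<le> y" "y \<le> u"
    have "(?f has_real_derivative 1 / (1 + y) - 1 + y) (at y)"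
      using y by (auto intro!: derivative_eq_intros)
    moreover have "1 / (1 + y) - 1 + y \<ge> 0"
      using y by (simp add: field_simps)
    ultimately show "\<exists>d. (?f has_real_derivative d) (at y) \<and> 0 \<le> d"
      by blast
  qed
  then show ?thesis by simp
qed

lemma abs_arctan_minus_le_cube:
  fixes x :: real
  shows "\<bar>arctan x - x\<bar> \<le> \<bar>x\<bar> ^ 3 / 3"
proof -
  have *: "x - x ^ 3 / 3 \<le> arctan x \<and> arctan x \<le> x" if x: "x \<ge> 0" for x :: real
  proof
    let ?f = "\<lambda>x. arctan x - x + x ^ 3 / 3"
    have "?f 0 \<le> ?f x"
    proof (rule DERIV_nonneg_imp_nondecreasing[OF x])
      fix y :: real
      have "(?f has_real_derivative inverse (1 + y\<^sup>2) - 1 + y\<^sup>2) (at y)"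
        by (auto intro!: derivative_eq_intros)
      moreover have "1 + y\<^sup>2 > 0"
        by (simp add: add_pos_nonneg)
      then have "inverse (1 + y\<^sup>2) - 1 + y\<^sup>2 \<ge> 0"
        by (simp add: field_simps)
      ultimately show "\<exists>d. (?f has_real_derivative d) (at y) \<and> 0 \<le> d"
        by blast
    qed
    then show "x - x ^ 3 / 3 \<le> arctan x" by simp
    show "arctan x \<le> x"
      using x by (rule arctan_le_self)
  qed
  show ?thesis
  proof (cases "x \<ge> 0")
    case True
    with *[of x] show ?thesis by auto
  next
    case False
    with *[of "-x"] show ?thesis by (auto simp: arctan_minus)
  qed
qed

text \<open>The sum of both exponentials on the right makes the bound independent of the sign of a.
  This suits the application, where both exponentials obey the same upper bound.\<close>

lemma abs_exp_diff_le:
  fixes a g :: real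
  shows "\<bar>exp (g + a) - exp g\<bar> \<le> \<bar>a\<bar> * (exp (g + a) + exp g)"
proof (cases "a \<ge> 0")
  case True
  have "1 - exp (- a) \<le> a"
    using exp_ge_add_one_self[of "-a"] by simp
  then have "exp (g + a) * (1 - exp (- a)) \<le> exp (g + a) * a"
    by (intro mult_left_mono) auto
  then have "exp (g + a) - exp g \<le> a * exp (g + a)"
    by (simp add: algebra_simps flip: exp_add)
  moreover have "0 \<le> a * exp g" "exp g \<le> exp (g + a)"
    using True by auto
  ultimately show ?thesis
    unfolding distrib_left abs_of_nonneg[OF True] by linarith
next
  case False
  have "1 - exp a \<le> - a"
    using exp_ge_add_one_self[of a] by linarith
  then have "exp g * (1 - exp a) \<le> exp g * (- a)"
    by (intro mult_left_mono) auto
  then have "exp g - exp (g + a) \<le> - a * exp g"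
    by (simp add: algebra_simps flip: exp_add)
  moreover have "a * exp (g + a) \<le> 0" "exp (g + a) \<le> exp g"
    using False by (auto intro: mult_nonpos_nonneg)
  moreover have "\<bar>a\<bar> = - a"
    using False by simp
  ultimately show ?thesis
    by (simp only: distrib_left mult_minus_left)
qed

lemma has_bochner_integral_gaussian:
  fixes c :: real
  assumes "c > 0"
  shows "has_bochner_integral lborel (\<lambda>t. exp (- c * t\<^sup>2 / 2)) (sqrt (2 * pi / c))"
proof -
  have eq: "exp (- c * t\<^sup>2 / 2) = sqrt (2 * pi / c) * normal_density 0 (1 / sqrt c) t" for t
    using assms by (simp add: normal_density_def power_divide real_sqrt_divide field_simps)
  show ?thesis
    unfolding eq has_bochner_integral_iff using assms by simp
qed

text \<open>The Cauchy profile is the integrable majorant both for the characteristic function and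
  for the error in the saddle point integral.\<close>

lemma has_bochner_integral_cauchy:
  fixes a :: real
  assumes "a > 0"
  shows "has_bochner_integral lborel (\<lambda>t. 1 / (1 + (t / a)\<^sup>2)) (a * pi)"
proof -
  have "has_bochner_integral lborel (\<lambda>t::real. 1 / (1 + t\<^sup>2)) pi"
    using integrable_inverse_1_plus_square LBINT_inverse_1_plus_square
    by (simp add: has_bochner_integral_iff set_integrable_def interval_lebesgue_integral_def
        set_lebesgue_integral_def inverse_eq_divide)
  with lborel_has_bochner_integral_real_affine_iff[of "1 / a" "\<lambda>t::real. 1 / (1 + t\<^sup>2)" pi 0] assms
  show ?thesis by simp
qed

section \<open>Modulus and phase of the infinite product of 1 / (1 - i t q_i)\<close>

text \<open>Minus the logarithm of the modulus, hence nonnegative for a summable series.\<close>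

definition cf_log_modulus :: "(nat \<Rightarrow> real) \<Rightarrow> real \<Rightarrow> real" where
  "cf_log_modulus q t = (\<Sum>i. ln (1 + (t * q i)\<^sup>2)) / 2"

text \<open>Summing the arguments of the factors gives a phase that is not reduced modulo 2 pi and
  can therefore be compared with the linear function t c.\<close>

definition cf_argument :: "(nat \<Rightarrow> real) \<Rightarrow> real \<Rightarrow> real" where
  "cf_argument q t = (\<Sum>i. arctan (t * q i))"

lemma inverse_one_minus_ix:
  fixes x :: real
  shows "1 / (1 - \<i> * x) = exp (of_real (- ln (1 + x\<^sup>2) / 2) + \<i> * arctan x)"
proof -
  have pos: "1 + x\<^sup>2 > 0"
    by (simp add: add_pos_nonneg)
  have "exp (- ln (1 + x\<^sup>2) / 2) = 1 / sqrt (1 + x\<^sup>2)"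
    using pos by (simp add: exp_minus ln_sqrt[symmetric] inverse_eq_divide)
  then have "exp (of_real (- ln (1 + x\<^sup>2) / 2) + \<i> * arctan x) = of_real (1 / sqrt (1 + x\<^sup>2)) * cis (arctan x)"
    unfolding exp_add cis_conv_exp exp_of_real by simp
  also have "\<dots> = Complex (1 / (1 + x\<^sup>2)) (x / (1 + x\<^sup>2))"
    using pos by (simp add: complex_eq_iff cos_arctan sin_arctan)
  also have "\<dots> = 1 / (1 - \<i> * x)"
    using pos by (simp add: complex_eq_iff Re_divide Im_divide power2_eq_square)
  finally show ?thesis ..
qed

context
  fixes q :: "nat \<Rightarrow> real"
  assumes q_nonneg: "\<And>i. 0 \<le> q i" and q_le_1: "\<And>i. q i \<le> 1" and q_summable: "summable q"
begin

lemma weight_power_le: "k \<ge> 1 \<Longrightarrow> q i ^ k \<le> q i"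
  using power_decreasing[of 1 k "q i"] q_nonneg q_le_1 by simp

lemma weight_power_summable: "k \<ge> 1 \<Longrightarrow> summable (\<lambda>i. q i ^ k)"
  by (rule summable_comparison_test'[OF q_summable]) (use q_nonneg weight_power_le in auto)

lemma weight_ln_summable: "summable (\<lambda>i. ln (1 + (t * q i)\<^sup>2))"
proof (rule summable_comparison_test')
  show "summable (\<lambda>i. t\<^sup>2 * q i ^ 2)"
    by (intro summable_mult weight_power_summable) auto
  show "norm (ln (1 + (t * q i)\<^sup>2)) \<le> t\<^sup>2 * q i ^ 2" for i
    using ln_add_one_self_le_self[of "(t * q i)\<^sup>2"] by (simp add: power_mult_distrib)
qed

lemma weight_arctan_summable: "summable (\<lambda>i. arctan (t * q i))"
proof (rule summable_comparison_test')
  show "summable (\<lambda>i. \<bar>t\<bar> * q i)"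
    by (intro summable_mult q_summable)
  show "norm (arctan (t * q i)) \<le> \<bar>t\<bar> * q i" for i
    using abs_arctan_le[of "t * q i"] q_nonneg[of i] by (simp add: abs_mult)
qed

text \<open>With each factor in polar form, convergence of the product reduces to that of two
  series, with terms of order q_i^2 for the modulus and q_i for the phase.\<close>

lemma prod_inverse_tendsto:
  "(\<lambda>n. \<Prod>i<n. 1 / (1 - \<i> * complex_of_real (t * q i))) \<longlonglongrightarrow>
     exp (of_real (- cf_log_modulus q t) + \<i> * cf_argument q t)"
proof -
  have "(\<lambda>i. of_real (- ln (1 + (t * q i)\<^sup>2) / 2) + \<i> * complex_of_real (arctan (t * q i))) sums
     (of_real (- (\<Sum>i. ln (1 + (t * q i)\<^sup>2)) / 2) + \<i> * complex_of_real (cf_argument q t))"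
    unfolding cf_argument_def
    by (intro sums_add sums_of_real sums_mult sums_divide sums_minus summable_sums weight_ln_summable weight_arctan_summable)
  then have "(\<lambda>n. exp (\<Sum>i<n. of_real (- ln (1 + (t * q i)\<^sup>2) / 2) + \<i> * complex_of_real (arctan (t * q i)))) \<longlonglongrightarrow>
     exp (of_real (- (\<Sum>i. ln (1 + (t * q i)\<^sup>2)) / 2) + \<i> * complex_of_real (cf_argument q t))"
    unfolding sums_def by (intro tendsto_exp)
  then show ?thesis
    unfolding inverse_one_minus_ix cf_log_modulus_def by (simp add: exp_sum del: of_real_divide)
qed

text \<open>All terms are nonnegative, so only the first n are kept. Taken with n = 2 this makes the
  characteristic function integrable; with n >= c it gives the decay of the saddle point
  integrand.\<close>

lemma cf_log_modulus_ge:
  fixes n :: nat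
  assumes half: "\<And>i. i < n \<Longrightarrow> q i \<ge> 1/2"
  shows "cf_log_modulus q t \<ge> n * ln (1 + t\<^sup>2 / 4) / 2"
proof -
  have "n * ln (1 + t\<^sup>2 / 4) = (\<Sum>i<n. ln (1 + t\<^sup>2 / 4))"
    by simp
  also have "\<dots> \<le> (\<Sum>i<n. ln (1 + (t * q i)\<^sup>2))"
  proof (intro sum_mono)
    fix i assume "i \<in> {..<n}"
    then have "(1/2)\<^sup>2 \<le> (q i)\<^sup>2"
      using half by (intro power_mono) auto
    then have "t\<^sup>2 / 4 \<le> (t * q i)\<^sup>2"
      using mult_left_mono[of "(1/2)\<^sup>2" "(q i)\<^sup>2" "t\<^sup>2"] by (simp add: power_mult_distrib power_divide)
    then show "ln (1 + t\<^sup>2 / 4) \<le> ln (1 + (t * q i)\<^sup>2)"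
      by (subst ln_le_cancel_iff) (auto simp: add_pos_nonneg)
  qed
  also have "\<dots> \<le> (\<Sum>i. ln (1 + (t * q i)\<^sup>2))"
    by (intro sum_le_suminf weight_ln_summable) auto
  finally show ?thesis
    by (simp add: cf_log_modulus_def)
qed

text \<open>The constants 4 and 6 leave room for the power sums of the weights in
  \<open>prob_Yinf_approx\<close>. The bound c >= 8 makes c/8 an admissible exponent in
  \<open>powr_Bernoulli\<close>.\<close>

context
  fixes c :: real and n :: nat
  assumes c: "c \<ge> 8" and n: "real n \<ge> c"
    and half: "\<And>i. i < n \<Longrightarrow> q i \<ge> 1/2"
    and sum1: "\<bar>suminf q - c\<bar> \<le> 4"
    and sum2: "\<bar>(\<Sum>i. (q i)\<^sup>2) - c\<bar> \<le> 6"
begin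

lemma weight_power_suminf_le: "k \<ge> 1 \<Longrightarrow> (\<Sum>i. q i ^ k) \<le> 2 * c"
  using suminf_le[OF weight_power_le weight_power_summable q_summable, of k] sum1 c by linarith

text \<open>The inequalities u - u^2/2 <= ln (1+u) <= u at u = (t q_i)^2 are summed, using that the
  squares of the weights sum to c + O(1) and the fourth powers to at most 2c. In the Gaussian scale
  c t^2 the gain 1/c becomes explicit.\<close>

lemma cf_log_modulus_approx: "\<bar>c * t\<^sup>2 / 2 - cf_log_modulus q t\<bar> \<le> (3 * (c * t\<^sup>2) + (c * t\<^sup>2)\<^sup>2 / 2) / c"
proof -
  let ?L = "\<Sum>i. ln (1 + (t * q i)\<^sup>2)"
  have s2: "summable (\<lambda>i. t\<^sup>2 * (q i)\<^sup>2)" and s4: "summable (\<lambda>i. t ^ 4 / 2 * q i ^ 4)"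
    by (intro summable_mult weight_power_summable; simp)+
  have "?L \<le> (\<Sum>i. t\<^sup>2 * (q i)\<^sup>2)"
    using ln_add_one_self_le_self[of "(t * q _)\<^sup>2"]
    by (intro suminf_le weight_ln_summable s2) (simp add: power_mult_distrib)
  also have "\<dots> = t\<^sup>2 * (\<Sum>i. (q i)\<^sup>2)"
    by (rule suminf_mult) (rule weight_power_summable, simp)
  finally have upper: "?L \<le> t\<^sup>2 * (\<Sum>i. (q i)\<^sup>2)" .
  have "t\<^sup>2 * (\<Sum>i. (q i)\<^sup>2) - t ^ 4 / 2 * (\<Sum>i. q i ^ 4) = (\<Sum>i. t\<^sup>2 * (q i)\<^sup>2 - t ^ 4 / 2 * q i ^ 4)"
    using suminf_diff[OF s2 s4] suminf_mult[OF weight_power_summable[of 2], of "t\<^sup>2"] suminf_mult[OF weight_power_summable[of 4], of "t^4/2"]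
    by simp
  also have "\<dots> \<le> ?L"
    using ln_one_plus_ge_quadratic[of "(t * q _)\<^sup>2"]
    by (intro suminf_le weight_ln_summable summable_diff s2 s4) (simp add: power_mult_distrib flip: power_mult)
  finally have lower: "t\<^sup>2 * (\<Sum>i. (q i)\<^sup>2) - t ^ 4 / 2 * (\<Sum>i. q i ^ 4) \<le> ?L" .
  have "t ^ 4 / 2 * (\<Sum>i. q i ^ 4) \<le> t ^ 4 / 2 * (2 * c)"
    by (intro mult_left_mono weight_power_suminf_le) auto
  moreover have "t\<^sup>2 * \<bar>(\<Sum>i. (q i)\<^sup>2) - c\<bar> \<le> t\<^sup>2 * 6"
    by (intro mult_left_mono sum2) auto
  then have "\<bar>t\<^sup>2 * (\<Sum>i. (q i)\<^sup>2) - t\<^sup>2 * c\<bar> \<le> t\<^sup>2 * 6"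
    by (simp add: abs_mult flip: right_diff_distrib)
  ultimately have "\<bar>c * t\<^sup>2 - ?L\<bar> \<le> 6 * t\<^sup>2 + c * t ^ 4"
  proof -
    have "0 \<le> c * t ^ 4" "t ^ 4 / 2 * (2 * c) = c * t ^ 4" "t\<^sup>2 * c = c * t\<^sup>2"
      using c by auto
    then show ?thesis
      using upper lower \<open>t ^ 4 / 2 * (\<Sum>i. q i ^ 4) \<le> t ^ 4 / 2 * (2 * c)\<close>
        \<open>\<bar>t\<^sup>2 * (\<Sum>i. (q i)\<^sup>2) - t\<^sup>2 * c\<bar> \<le> t\<^sup>2 * 6\<close> by linarith
  qed
  moreover have "(3 * (c * t\<^sup>2) + (c * t\<^sup>2)\<^sup>2 / 2) / c = (6 * t\<^sup>2 + c * t ^ 4) / 2"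
    using c by (simp add: field_simps power2_eq_square power4_eq_xxxx)
  ultimately show ?thesis
    unfolding cf_log_modulus_def by argo
qed

text \<open>Since arctan x = x + O(x^3) and the weights sum to c + O(1), the phase is O(|t| + c
  |t|^3). Its square is estimated because the cosine deviates from 1 only quadratically, which gives
  an error of order 1/c, not 1/sqrt c.\<close>

lemma cf_argument_approx: "(cf_argument q t - t * c)\<^sup>2 \<le> (32 * (c * t\<^sup>2) + (c * t\<^sup>2) ^ 3) / c"
proof -
  have s3: "summable (\<lambda>i. \<bar>t\<bar> ^ 3 / 3 * q i ^ 3)"
    by (intro summable_mult weight_power_summable) simp
  have b: "norm (arctan (t * q i) - t * q i) \<le> \<bar>t\<bar> ^ 3 / 3 * q i ^ 3" for i
    using abs_arctan_minus_le_cube[of "t * q i"] q_nonneg[of i] by (simp add: abs_mult power_mult_distrib)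
  have "\<bar>cf_argument q t - t * suminf q\<bar> = norm (\<Sum>i. arctan (t * q i) - t * q i)"
    unfolding cf_argument_def
    using suminf_diff[OF weight_arctan_summable[of t] summable_mult[OF q_summable, of t]] suminf_mult[OF q_summable, of t] by simp
  also have "\<dots> \<le> (\<Sum>i. norm (arctan (t * q i) - t * q i))"
    using b by (intro summable_norm summable_comparison_test'[OF s3]) auto
  also have "\<dots> \<le> (\<Sum>i. \<bar>t\<bar> ^ 3 / 3 * q i ^ 3)"
    using b by (intro suminf_le s3 summable_comparison_test'[OF s3]) auto
  also have "\<dots> = \<bar>t\<bar> ^ 3 / 3 * (\<Sum>i. q i ^ 3)"
    by (rule suminf_mult) (rule weight_power_summable, simp)
  also have "\<dots> \<le> \<bar>t\<bar> ^ 3 / 3 * (2 * c)"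
    by (intro mult_left_mono weight_power_suminf_le) auto
  finally have 1: "\<bar>cf_argument q t - t * suminf q\<bar> \<le> \<bar>t\<bar> ^ 3 / 3 * (2 * c)" .
  have "\<bar>t\<bar> * \<bar>suminf q - c\<bar> \<le> \<bar>t\<bar> * 4"
    by (intro mult_left_mono sum1) auto
  then have 2: "\<bar>t * suminf q - t * c\<bar> \<le> \<bar>t\<bar> * 4"
    by (simp add: abs_mult flip: right_diff_distrib)
  have "\<bar>cf_argument q t - t * c\<bar> \<le> \<bar>t\<bar> * 4 + \<bar>t\<bar> ^ 3 / 3 * (2 * c)" (is "_ \<le> ?x + ?y")
    using 1 2 by linarith
  then have "(cf_argument q t - t * c)\<^sup>2 \<le> (?x + ?y)\<^sup>2"
    by (metis abs_ge_zero power2_abs power_mono)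
  also have "\<dots> \<le> 2 * ?x\<^sup>2 + 2 * ?y\<^sup>2"
    using zero_le_power2[of "?x - ?y"] by (simp add: power2_eq_square algebra_simps)
  also have "?x\<^sup>2 = 16 * t\<^sup>2"
    by (simp add: power_mult_distrib)
  also have "?y\<^sup>2 = 4 / 9 * (c\<^sup>2 * t ^ 6)"
    by (simp add: power_mult_distrib power_divide flip: power_mult)
  also have "2 * (16 * t\<^sup>2) + 2 * (4 / 9 * (c\<^sup>2 * t ^ 6)) \<le> 32 * t\<^sup>2 + c\<^sup>2 * t ^ 6"
    using mult_nonneg_nonneg[of "c\<^sup>2" "t ^ 6"] by simp
  also have "\<dots> = (32 * (c * t\<^sup>2) + (c * t\<^sup>2) ^ 3) / c"
    using c by (simp add: field_simps eval_nat_numeral)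
  finally show ?thesis .
qed

text \<open>
  For \<open>c \<ge> 8\<close> both the modulus and the Gaussian are at most \<open>(1 + ct\<^sup>2 / 32)\<^sup>-\<^sup>4\<close>, which absorbs the
  error terms, cubic in \<open>ct\<^sup>2\<close>, and leaves an integrable bound.
\<close>

lemma saddle_integrand_approx:
  "\<bar>exp (- cf_log_modulus q t) * cos (cf_argument q t - t * c) - exp (- c * t\<^sup>2 / 2)\<bar>
     \<le> 18112 / c * (1 / (1 + (t / sqrt (32 / c))\<^sup>2))"
proof -
  define w y where "w = c * t\<^sup>2" and "y = 1 + w / 32"
  have w: "w \<ge> 0" using c by (simp add: w_def)
  have y: "y \<ge> 1" using w by (simp add: y_def)
  define r g b where "r = exp (- cf_log_modulus q t)" and "g = exp (- w / 2)" and "b = cf_argument q t - t * c"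
  have "4 * ln y \<le> w / 8"
    using ln_add_one_self_le_self[of "w / 32"] w by (simp add: y_def)
  moreover have "4 * ln y \<le> cf_log_modulus q t"
  proof -
    \<comment> \<open>Bernoulli with exponent c/8 gives 1 + (c/8)(t^2/4) = 1 + c t^2/32, which fixes
      the 32 in \<open>y\<close>; the exponent c/2 of the modulus bound then supplies four powers of
      \<open>y\<close>.\<close>
    have "y \<le> (1 + t\<^sup>2 / 4) powr (c / 8)"
      using powr_Bernoulli[of "t\<^sup>2 / 4" "c / 8"] c by (simp add: y_def w_def)
    then have "ln y \<le> ln ((1 + t\<^sup>2 / 4) powr (c / 8))"
      using y by (subst ln_le_cancel_iff) (auto simp: add_pos_nonneg)
    also have "\<dots> = c / 8 * ln (1 + t\<^sup>2 / 4)"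
      by (simp add: ln_powr)
    finally have "4 * ln y \<le> c * ln (1 + t\<^sup>2 / 4) / 2" by simp
    also have "\<dots> \<le> n * ln (1 + t\<^sup>2 / 4) / 2"
      using n by (intro divide_right_mono mult_right_mono) auto
    also have "\<dots> \<le> cf_log_modulus q t"
      by (rule cf_log_modulus_ge[OF half])
    finally show ?thesis .
  qed
  moreover have "exp (- (4 * ln y)) = 1 / y ^ 4"
    using y exp_of_nat_mult[of 4 "ln y"] by (simp add: exp_minus inverse_eq_divide)
  ultimately have r: "0 \<le> r" "r \<le> 1 / y ^ 4" and g: "0 \<le> g" "g \<le> 1 / y ^ 4"
    using w unfolding r_def g_def by (auto simp flip: \<open>exp (- (4 * ln y)) = 1 / y ^ 4\<close>)
  have "\<bar>r - g\<bar> \<le> \<bar>w / 2 - cf_log_modulus q t\<bar> * (r + g)"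
    using abs_exp_diff_le[of "- w / 2" "w / 2 - cf_log_modulus q t"] by (simp add: r_def g_def)
  also have "\<dots> \<le> (3 * w + w\<^sup>2 / 2) / c * (1 / y ^ 4 + 1 / y ^ 4)"
    using cf_log_modulus_approx[of t] r g by (intro mult_mono add_mono) (auto simp: w_def)
  also have "\<dots> = (6 * w + w\<^sup>2) / c * (1 / y ^ 4)"
    unfolding mult_2[symmetric] by (simp add: algebra_simps add_divide_distrib)
  finally have 1: "\<bar>r - g\<bar> \<le> (6 * w + w\<^sup>2) / c * (1 / y ^ 4)" .
  have "1 - cos b \<le> b\<^sup>2 / 2"
  proof -
    have "(sin (b / 2))\<^sup>2 \<le> (b / 2)\<^sup>2"
      using abs_sin_x_le_abs_x[of "b / 2"] by (subst abs_le_square_iff[symmetric])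
    then show ?thesis
      using cos_double_sin[of "b / 2"] by (simp add: power_divide)
  qed
  then have "\<bar>cos b - 1\<bar> \<le> (32 * w + w ^ 3) / c / 2"
    using cf_argument_approx[of t] cos_le_one[of b] by (simp add: b_def w_def)
  then have "r * \<bar>cos b - 1\<bar> \<le> 1 / y ^ 4 * ((32 * w + w ^ 3) / c / 2)"
    using r by (intro mult_mono) auto
  then have 2: "\<bar>r * cos b - r\<bar> \<le> (16 * w + w ^ 3 / 2) / c * (1 / y ^ 4)"
  proof -
    have "r * cos b - r = r * (cos b - 1)"
      by (simp add: algebra_simps)
    then have "\<bar>r * cos b - r\<bar> = r * \<bar>cos b - 1\<bar>"
      using r by (simp add: abs_mult)
    moreover have "1 / y ^ 4 * ((32 * w + w ^ 3) / c / 2) = (16 * w + w ^ 3 / 2) / c * (1 / y ^ 4)"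
      by (simp add: algebra_simps add_divide_distrib)
    ultimately show ?thesis
      using \<open>r * \<bar>cos b - 1\<bar> \<le> 1 / y ^ 4 * ((32 * w + w ^ 3) / c / 2)\<close> by linarith
  qed
  have "\<bar>r * cos b - g\<bar> \<le> \<bar>r * cos b - r\<bar> + \<bar>r - g\<bar>"
    by linarith
  also have "\<dots> \<le> (22 * w + w\<^sup>2 + w ^ 3 / 2) / c * (1 / y ^ 4)"
    using add_mono[OF 2 1] by (simp add: add_divide_distrib distrib_right algebra_simps)
  \<comment> \<open>From w <= 32 y and y >= 1: 22 * 32 + 32^2 + 32^3 / 2 = 18112.\<close>
  also have "\<dots> \<le> (18112 * y ^ 3) / c * (1 / y ^ 4)"
  proof (intro mult_right_mono divide_right_mono)
    have wy: "w \<le> 32 * y" by (simp add: y_def)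
    have "y \<le> y ^ 3" "y\<^sup>2 \<le> y ^ 3"
      using y power_increasing[of 1 3 y] power_increasing[of 2 3 y] by auto
    moreover have "w\<^sup>2 \<le> 1024 * y\<^sup>2" "w ^ 3 \<le> 32768 * y ^ 3"
      using power_mono[OF wy w, of 2] power_mono[OF wy w, of 3] by (simp_all add: power_mult_distrib)
    ultimately show "22 * w + w\<^sup>2 + w ^ 3 / 2 \<le> 18112 * y ^ 3"
      using wy by linarith
  qed (use c y in auto)
  also have "\<dots> = 18112 / c * (1 / y)"
    using y by (simp add: field_simps power4_eq_xxxx power3_eq_cube)
  also have "y = 1 + (t / sqrt (32 / c))\<^sup>2"
    using c by (simp add: y_def w_def power_divide field_simps)
  finally show ?thesis
    by (simp add: r_def g_def b_def w_def)
qed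

lemma saddle_integral_approx:
  "\<bar>(LBINT t. exp (- cf_log_modulus q t) * cos (cf_argument q t - t * c)) - sqrt (2 * pi / c)\<bar>
     \<le> 72448 * pi / c * sqrt (2 * pi / c)"
proof -
  let ?h = "\<lambda>t. exp (- cf_log_modulus q t) * cos (cf_argument q t - t * c)"
  let ?g = "\<lambda>t. exp (- c * t\<^sup>2 / 2)"
  let ?d = "\<lambda>t. 18112 / c * (1 / (1 + (t / sqrt (32 / c))\<^sup>2))"
  have [measurable]: "?h \<in> borel_measurable borel"
    unfolding cf_log_modulus_def cf_argument_def by measurable
  have g: "has_bochner_integral lborel ?g (sqrt (2 * pi / c))"
    using c by (intro has_bochner_integral_gaussian) simp
  have d: "has_bochner_integral lborel ?d (18112 / c * (sqrt (32 / c) * pi))"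
    using c by (intro has_bochner_integral_mult_right has_bochner_integral_cauchy) simp
  \<comment> \<open>The pointwise estimate controls the difference from the Gaussian; integrability
    of the oscillating integrand itself is then recovered by adding the Gaussian back.\<close>
  have di: "integrable lborel (\<lambda>t. ?h t - ?g t)"
  proof (rule Bochner_Integration.integrable_bound)
    show "integrable lborel ?d"
      using d by (rule integrable.intros)
    show "AE t in lborel. norm (?h t - ?g t) \<le> norm (?d t)"
      using order.trans[OF saddle_integrand_approx abs_ge_self] by simp
  qed measurable
  have hi: "integrable lborel ?h"
    using Bochner_Integration.integrable_add[OF di integrable.intros[OF g]] by simp
  have "\<bar>(LBINT t. ?h t) - sqrt (2 * pi / c)\<bar> = norm (LBINT t. ?h t - ?g t)"
    using Bochner_Integration.integral_diff[OF hi integrable.intros[OF g]]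
      has_bochner_integral_integral_eq[OF g] by simp
  also have "\<dots> \<le> (LBINT t. ?d t)"
    using saddle_integrand_approx
    by (intro Bochner_Integration.integral_norm_bound_integral di integrable.intros[OF d]) simp
  also have "\<dots> = 18112 / c * (sqrt (32 / c) * pi)"
    using d by (rule has_bochner_integral_integral_eq)
  \<comment> \<open>The error is made relative to the main term through 32 <= 16 * 2 pi; this gives
    4 * 18112 = 72448.\<close>
  also have "\<dots> \<le> 18112 / c * (4 * sqrt (2 * pi / c) * pi)"
  proof (intro mult_left_mono mult_right_mono)
    have "sqrt (32 / c) \<le> sqrt (16 * (2 * pi / c))"
      using c pi_ge_two by (intro real_sqrt_le_mono) (simp add: divide_right_mono)
    also have "\<dots> = 4 * sqrt (2 * pi / c)"
      using real_sqrt_mult[of 16 "2 * pi / c"] by simp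
    finally show "sqrt (32 / c) \<le> 4 * sqrt (2 * pi / c)" .
  qed (use c in auto)
  finally show ?thesis
    by (simp add: field_simps)
qed

end

end

section \<open>Tilting the law of the exponential series\<close>

locale exponential_sequence = prob_space M for M :: "'a measure" +
  fixes W :: "nat \<Rightarrow> 'a \<Rightarrow> real"
  assumes indep: "indep_vars (\<lambda>_. borel) W {1..}"
    and distr: "\<And>i. i \<ge> 1 \<Longrightarrow> distributed M lborel (W i) (exponential_density 1)"
begin

lemma W_measurable [measurable]: "W (Suc i) \<in> borel_measurable M"
  using distributed_measurable[OF distr[of "Suc i"]] by simp

lemma Yinf_measurable [measurable]: "Yinf W \<in> borel_measurable M"
  unfolding Yinf_def[abs_def] Suc_eq_plus1[symmetric] by measurable

lemma AE_W_nonneg: "AE \<omega> in M. \<forall>i. 0 \<le> W (Suc i) \<omega>"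
  unfolding AE_all_countable
proof
  fix i
  show "AE \<omega> in M. 0 \<le> W (Suc i) \<omega>"
    by (subst distributed_AE2[OF distr]) (auto simp: exponential_density_def)
qed

lemma expectation_exp_W:
  fixes w :: complex
  assumes w: "Re w \<ge> 0"
  shows "(CLINT \<omega>|M. exp (- w * of_real (W (Suc i) \<omega>))) = 1 / (1 + w)"
proof -
  let ?g = "\<lambda>x::real. exp (- w * of_real x)"
  have "(CLINT \<omega>|M. ?g (W (Suc i) \<omega>)) = (CLINT x|distr M lborel (W (Suc i)). ?g x)"
    by (subst integral_distr) auto
  also have "distr M lborel (W (Suc i)) = density lborel (exponential_density 1)"
    using distr[of "Suc i"] by (simp add: distributed_def)
  also have "(CLINT x|density lborel (exponential_density 1). ?g x) = (CLBINT x. exponential_density 1 x *\<^sub>R ?g x)"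
    by (subst integral_density) (auto simp: exponential_density_nonneg)
  also have "\<dots> = (CLBINT x. indicator {0<..} x *\<^sub>R exp (- (1 + w) * of_real x))"
  proof (rule Bochner_Integration.integral_cong_AE)
    show "AE x in lborel. exponential_density 1 x *\<^sub>R ?g x = indicator {0<..} x *\<^sub>R exp (- (1 + w) * of_real x)"
    \<comment> \<open>The exponential density is 1 at the origin, whereas the open half-line
      excludes it.\<close>
    proof (rule AE_I[of _ _ "{0}"])
      show "{x \<in> space lborel. exponential_density 1 x *\<^sub>R ?g x \<noteq> indicator {0<..} x *\<^sub>R exp (- (1 + w) * of_real x)} \<subseteq> {0}"
        by (auto simp: exponential_density_def indicator_def scaleR_conv_of_real algebra_simps
            simp flip: exp_of_real exp_add)
    qed auto
  qed auto
  also have "\<dots> = 1 / (1 + w)"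
    by (rule has_bochner_integral_integral_eq[OF has_bochner_integral_exp_complex]) (use w in auto)
  finally show ?thesis .
qed

text \<open>The series of nonnegative terms has finite expectation, the sum of (1/2)^i, so it is
  finite almost surely. This is what lets the \<open>suminf\<close> in \<open>Yinf\<close> be
  treated as a genuine limit.\<close>

lemma AE_summable: "AE \<omega> in M. summable (\<lambda>i. W (Suc i) \<omega> / 2 ^ i)"
proof -
  have 1: "(\<integral>\<^sup>+ \<omega>. ennreal (W (Suc i) \<omega> / 2 ^ i) \<partial>M) = ennreal ((1/2) ^ i)" for i
  proof -
    have "has_bochner_integral M (W (Suc i)) 1"
      using has_bochner_integral_erlang_ith_moment[of 1 "W (Suc i)" 0 1] distr[of "Suc i"] by simp
    then have "has_bochner_integral M (\<lambda>\<omega>. W (Suc i) \<omega> / 2 ^ i) (1 / 2 ^ i)"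
      by (rule has_bochner_integral_divide_zero)
    then show ?thesis
      using AE_W_nonneg by (subst nn_integral_eq_integral)
        (auto simp: has_bochner_integral_iff power_divide elim!: eventually_mono)
  qed
  have "(\<integral>\<^sup>+ \<omega>. (\<Sum>i. ennreal (W (Suc i) \<omega> / 2 ^ i)) \<partial>M) = (\<Sum>i. ennreal ((1/2) ^ i))"
    by (subst nn_integral_suminf) (auto simp: 1)
  also have "\<dots> = ennreal (\<Sum>i. (1/2) ^ i)"
    by (intro suminf_ennreal2 summable_geometric) auto
  finally have "AE \<omega> in M. (\<Sum>i. ennreal (W (Suc i) \<omega> / 2 ^ i)) \<noteq> \<infinity>"
    by (intro nn_integral_PInf_AE) auto
  with AE_W_nonneg show ?thesis
    by eventually_elim (auto intro!: summable_suminf_not_top)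
qed

lemma AE_Yinf_nonneg: "AE \<omega> in M. Yinf W \<omega> \<ge> 0"
  using AE_W_nonneg AE_summable
  by eventually_elim (auto simp: Yinf_def intro!: suminf_nonneg)

text \<open>Independence factorises the transform of each partial sum. Since Re w >= 0 and the
  variables are nonnegative, the constant 1 dominates in the passage to the limit.\<close>

lemma Laplace_transform_tendsto:
  fixes w :: complex
  assumes w: "Re w \<ge> 0"
  shows "(\<lambda>n. \<Prod>i<n. 1 / (1 + w / 2 ^ i)) \<longlonglongrightarrow> (CLINT \<omega>|M. exp (- w * of_real (Yinf W \<omega>)))"
proof -
  have Re_w: "Re (w / 2 ^ j) = Re w / 2 ^ j" for j
    by (metis Re_divide_of_real of_real_numeral of_real_power)
  have eq: "(CLINT \<omega>|M. exp (- w * of_real (\<Sum>i<n. W (Suc i) \<omega> / 2 ^ i))) = (\<Prod>i<n. 1 / (1 + w / 2 ^ i))" for n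
  proof -
    let ?X = "\<lambda>i \<omega>. exp (- (w / 2 ^ (i - 1)) * complex_of_real (W i \<omega>))"
    have ind: "indep_vars (\<lambda>_. borel) ?X {1..n}"
      by (intro indep_vars_compose2[OF indep_vars_subset[OF indep]]) auto
    have "(CLINT \<omega>|M. exp (- w * of_real (\<Sum>i<n. W (Suc i) \<omega> / 2 ^ i))) = (CLINT \<omega>|M. \<Prod>i\<in>{1..n}. ?X i \<omega>)"
    proof (intro Bochner_Integration.integral_cong refl)
      fix \<omega>
      have "- w * of_real (\<Sum>i<n. W (Suc i) \<omega> / 2 ^ i) = (\<Sum>i<n. - (w / 2 ^ i) * complex_of_real (W (Suc i) \<omega>))"
        by (simp add: sum_distrib_left sum_negf)
      also have "\<dots> = (\<Sum>i\<in>{1..n}. - (w / 2 ^ (i - 1)) * complex_of_real (W i \<omega>))"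
        by (rule sum.reindex_bij_witness[of _ "\<lambda>i. i - 1" Suc]) auto
      finally show "exp (- w * of_real (\<Sum>i<n. W (Suc i) \<omega> / 2 ^ i)) = (\<Prod>i\<in>{1..n}. ?X i \<omega>)"
        by (simp only: exp_sum finite_atLeastAtMost)
    qed
    also have "\<dots> = (\<Prod>i\<in>{1..n}. CLINT \<omega>|M. ?X i \<omega>)"
    proof (rule indep_vars_lebesgue_integral)
      fix i assume "i \<in> {1..n}"
      then obtain j where j: "i = Suc j" by (cases i) auto
      show "integrable M (?X i)"
        unfolding j
      proof (rule integrable_const_bound[where B = 1])
        show "AE \<omega> in M. norm (?X (Suc j) \<omega>) \<le> 1"
          using AE_W_nonneg
        proof eventually_elim
          case (elim \<omega>)
          then have "Re w / 2 ^ j * W (Suc j) \<omega> \<ge> 0"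
            using w by (intro mult_nonneg_nonneg) auto
          then show ?case
            by (simp add: Re_w)
        qed
      qed auto
    qed (use ind in auto)
    also have "\<dots> = (\<Prod>i\<in>{1..n}. 1 / (1 + w / 2 ^ (i - 1)))"
    proof (intro prod.cong refl)
      fix i assume "i \<in> {1..n}"
      then obtain j where j: "i = Suc j" by (cases i) auto
      show "(CLINT \<omega>|M. ?X i \<omega>) = 1 / (1 + w / 2 ^ (i - 1))"
        unfolding j using w
        by (subst expectation_exp_W) (simp_all add: Re_w)
    qed
    also have "\<dots> = (\<Prod>i<n. 1 / (1 + w / 2 ^ i))"
      by (rule prod.reindex_bij_witness[of _ Suc "\<lambda>i. i - 1"]) auto
    finally show ?thesis .
  qed
  have "(\<lambda>n. CLINT \<omega>|M. exp (- w * of_real (\<Sum>i<n. W (Suc i) \<omega> / 2 ^ i))) \<longlonglongrightarrow> (CLINT \<omega>|M. exp (- w * of_real (Yinf W \<omega>)))"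
  proof (rule integral_dominated_convergence[where w = "\<lambda>_. 1"])
    show "AE \<omega> in M. (\<lambda>n. exp (- w * of_real (\<Sum>i<n. W (Suc i) \<omega> / 2 ^ i))) \<longlonglongrightarrow> exp (- w * of_real (Yinf W \<omega>))"
      using AE_summable
    proof eventually_elim
      case (elim \<omega>)
      then have "(\<lambda>n. \<Sum>i<n. W (Suc i) \<omega> / 2 ^ i) \<longlonglongrightarrow> Yinf W \<omega>"
        unfolding Yinf_def using summable_LIMSEQ[OF elim] by simp
      then show ?case
        by (intro tendsto_intros)
    qed
    show "AE \<omega> in M. norm (exp (- w * of_real (\<Sum>i<n. W (Suc i) \<omega> / 2 ^ i))) \<le> 1" for n
      using AE_W_nonneg
    proof eventually_elim
      case (elim \<omega>)
      then have "Re w * (\<Sum>i<n. W (Suc i) \<omega> / 2 ^ i) \<ge> 0"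
        using w by (intro mult_nonneg_nonneg sum_nonneg) auto
      then show ?case by (simp del: of_real_sum)
    qed
  qed auto
  then show ?thesis unfolding eq .
qed

text \<open>The Esscher transform of the law of \<open>Yinf\<close>, rescaled by s so that the
  threshold c/s becomes c.\<close>

definition tilted :: "real \<Rightarrow> real measure" where
  "tilted s = distr (density M (\<lambda>\<omega>. exp (- s * Yinf W \<omega>) / (LINT \<omega>|M. exp (- s * Yinf W \<omega>)))) borel
                (\<lambda>\<omega>. s * Yinf W \<omega>)"

lemma integrable_exp_Yinf:
  assumes "s \<ge> 0"
  shows "integrable M (\<lambda>\<omega>. exp (- s * Yinf W \<omega>))"
proof (rule integrable_const_bound[where B = 1])
  show "AE \<omega> in M. norm (exp (- s * Yinf W \<omega>)) \<le> 1"
    using AE_Yinf_nonneg by eventually_elim (use assms in auto)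
qed auto

lemma Laplace_Yinf_pos:
  assumes "s \<ge> 0"
  shows "(LINT \<omega>|M. exp (- s * Yinf W \<omega>)) > 0"
  using integral_less_AE_space[of "\<lambda>_. 0" "\<lambda>\<omega>. exp (- s * Yinf W \<omega>)"] integrable_exp_Yinf[OF assms]
  by (simp add: emeasure_space_1)

lemma real_Laplace_transform_tendsto:
  assumes "s \<ge> 0"
  shows "(\<lambda>n. \<Prod>i<n. 1 / (1 + s / 2 ^ i)) \<longlonglongrightarrow> (LINT \<omega>|M. exp (- s * Yinf W \<omega>))"
proof -
  have "(\<lambda>n. complex_of_real (\<Prod>i<n. 1 / (1 + s / 2 ^ i))) \<longlonglongrightarrow> (CLINT \<omega>|M. of_real (exp (- s * Yinf W \<omega>)))"
    using Laplace_transform_tendsto[of "of_real s"] assms by (simp flip: exp_of_real)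
  then show ?thesis
    unfolding integral_complex_of_real tendsto_of_real_iff .
qed

lemma real_distribution_tilted:
  assumes "s \<ge> 0"
  shows "real_distribution (tilted s)"
proof -
  define L where "L = (LINT \<omega>|M. exp (- s * Yinf W \<omega>))"
  have "L > 0" unfolding L_def using assms by (rule Laplace_Yinf_pos)
  have "(\<integral>\<^sup>+ \<omega>. ennreal (exp (- s * Yinf W \<omega>) / L) \<partial>M) = ennreal (LINT \<omega>|M. exp (- s * Yinf W \<omega>) / L)"
    using integrable_exp_Yinf[OF assms] \<open>L > 0\<close> by (intro nn_integral_eq_integral) auto
  also have "\<dots> = 1"
    using \<open>L > 0\<close> by (simp add: L_def)
  finally have "prob_space (density M (\<lambda>\<omega>. exp (- s * Yinf W \<omega>) / L))"
    by (intro prob_spaceI) (simp add: emeasure_density)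
  then show ?thesis
    unfolding tilted_def L_def[symmetric]
    by (intro real_distribution.intro prob_space.prob_space_distr real_distribution_axioms.intro) auto
qed

lemma integral_tilted:
  fixes f :: "real \<Rightarrow> 'b::{banach, second_countable_topology}"
  assumes "s \<ge> 0" and [measurable]: "f \<in> borel_measurable borel"
  shows "(LINT x|tilted s. f x) =
     (LINT \<omega>|M. exp (- s * Yinf W \<omega>) *\<^sub>R f (s * Yinf W \<omega>)) /\<^sub>R (LINT \<omega>|M. exp (- s * Yinf W \<omega>))"
proof -
  define L where "L = (LINT \<omega>|M. exp (- s * Yinf W \<omega>))"
  have "L > 0" unfolding L_def using assms(1) by (rule Laplace_Yinf_pos)
  then show ?thesis
    unfolding tilted_def L_def[symmetric]
    by (subst integral_distr, simp, simp, subst integral_density)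
       (simp_all add: divide_inverse mult.commute[of _ "inverse L"] flip: scaleR_scaleR)
qed

text \<open>The characteristic function is the quotient L(s(1-it)) / L(s) of Laplace transforms,
  whose i-th factors have quotient 1 / (1 - i t p_i), with i in front of t the imaginary
  unit.\<close>

lemma char_tilted:
  assumes s: "s > 0"
  defines "p \<equiv> \<lambda>i. s / (2 ^ i + s)"
  shows "(\<lambda>n. \<Prod>i<n. 1 / (1 - \<i> * complex_of_real (t * p i))) \<longlonglongrightarrow> char (tilted s) t"
proof -
  define L where "L = (LINT \<omega>|M. exp (- s * Yinf W \<omega>))"
  have L: "L > 0" unfolding L_def using s by (intro Laplace_Yinf_pos) simp
  define w where "w = of_real s * (1 - \<i> * of_real t)"
  have "char (tilted s) t = (CLINT \<omega>|M. exp (- s * Yinf W \<omega>) *\<^sub>R iexp (t * (s * Yinf W \<omega>))) /\<^sub>R L"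
    unfolding char_def L_def using s by (intro integral_tilted) auto
  also have "(CLINT \<omega>|M. exp (- s * Yinf W \<omega>) *\<^sub>R iexp (t * (s * Yinf W \<omega>))) = (CLINT \<omega>|M. exp (- w * of_real (Yinf W \<omega>)))"
    by (intro Bochner_Integration.integral_cong)
       (auto simp: w_def scaleR_conv_of_real algebra_simps simp flip: exp_of_real exp_add)
  finally have char: "char (tilted s) t = (CLINT \<omega>|M. exp (- w * of_real (Yinf W \<omega>))) / of_real L"
    by (simp add: scaleR_conv_of_real divide_inverse mult.commute)
  have "(\<lambda>n. (\<Prod>i<n. 1 / (1 + w / 2 ^ i)) / of_real (\<Prod>i<n. 1 / (1 + s / 2 ^ i))) \<longlonglongrightarrow> char (tilted s) t"
    unfolding char L_def using L s
    by (intro tendsto_divide Laplace_transform_tendsto tendsto_of_real real_Laplace_transform_tendsto)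
       (auto simp: w_def L_def)
  also have "(\<lambda>n. (\<Prod>i<n. 1 / (1 + w / 2 ^ i)) / of_real (\<Prod>i<n. 1 / (1 + s / 2 ^ i)))
      = (\<lambda>n. \<Prod>i<n. 1 / (1 - \<i> * complex_of_real (t * p i)))"
  proof
    fix n
    have "1 / (1 + w / 2 ^ i) / of_real (1 / (1 + s / 2 ^ i)) = 1 / (1 - \<i> * complex_of_real (t * p i))" for i
    proof -
      have pos: "(2::real) ^ i + s > 0"
        using s by (simp add: add_pos_pos)
      then have nz: "(2::complex) ^ i + of_real s \<noteq> 0"
        by (metis of_real_add of_real_eq_0_iff of_real_numeral of_real_power less_irrefl)
      have "1 + w / 2 ^ i = (2 ^ i + of_real s - \<i> * of_real (t * s)) / 2 ^ i"
        by (simp add: w_def field_simps)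
      moreover have "of_real (1 / (1 + s / 2 ^ i)) = 2 ^ i / (2 ^ i + complex_of_real s)"
        using s by (simp add: field_simps)
      moreover have "1 - \<i> * complex_of_real (t * p i) = (2 ^ i + of_real s - \<i> * of_real (t * s)) / (2 ^ i + of_real s)"
        using nz by (simp add: p_def field_simps)
      ultimately show ?thesis
        using nz by simp
    qed
    then show "(\<Prod>i<n. 1 / (1 + w / 2 ^ i)) / of_real (\<Prod>i<n. 1 / (1 + s / 2 ^ i))
      = (\<Prod>i<n. 1 / (1 - \<i> * complex_of_real (t * p i)))"
      by (simp only: of_real_prod prod_dividef[symmetric])
  qed
  finally show ?thesis .
qed

text \<open>On the event the weight e^(y-c) at y = s Y cancels the tilt e^(-sY) and leaves the
  constant e^(-c). The convolution density at c is therefore the wanted probability up to explicit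
  factors.\<close>

lemma exp_convolution_tilted:
  assumes "s > 0"
  shows "(LINT y|tilted s. indicator {..c} y * exp (y - c)) =
     exp (- c) * measure M {\<omega> \<in> space M. s * Yinf W \<omega> \<le> c} / (LINT \<omega>|M. exp (- s * Yinf W \<omega>))"
proof -
  define L where "L = (LINT \<omega>|M. exp (- s * Yinf W \<omega>))"
  have "(LINT y|tilted s. indicator {..c} y * exp (y - c)) =
     (LINT \<omega>|M. exp (- s * Yinf W \<omega>) * (indicator {..c} (s * Yinf W \<omega>) * exp (s * Yinf W \<omega> - c))) / L"
    using assms by (subst integral_tilted) (auto simp: L_def divide_inverse mult.commute)
  also have "(LINT \<omega>|M. exp (- s * Yinf W \<omega>) * (indicator {..c} (s * Yinf W \<omega>) * exp (s * Yinf W \<omega> - c)))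
      = (LINT \<omega>|M. exp (- c) * indicator {\<omega> \<in> space M. s * Yinf W \<omega> \<le> c} \<omega>)"
    by (intro Bochner_Integration.integral_cong) (auto simp: indicator_def simp flip: exp_add)
  also have "\<dots> = exp (- c) * measure M {\<omega> \<in> space M. s * Yinf W \<omega> \<le> c}"
    by simp
  finally show ?thesis by (simp add: L_def)
qed

end

section \<open>Power sums of the tilted means\<close>

text \<open>The mean p_i at s = 2^c, equal to 1 / (1 + 2^(i-c)): a logistic profile that drops from
  1 to 0 around i = c.\<close>

definition tilted_mean :: "real \<Rightarrow> nat \<Rightarrow> real" where
  "tilted_mean c i = 2 powr c / (2 ^ i + 2 powr c)"

lemma tilted_mean_pos: "tilted_mean c i > 0"
  unfolding tilted_mean_def by (intro divide_pos_pos add_pos_pos) auto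

lemma tilted_mean_le: "tilted_mean c i \<le> 2 powr c / 2 ^ i"
  unfolding tilted_mean_def by (intro divide_left_mono) (auto simp: add_pos_pos)

lemma one_minus_tilted_mean_le: "1 - tilted_mean c i \<le> 2 ^ i / 2 powr c"
proof -
  have pos: "(2::real) ^ i + 2 powr c > 0"
    by (simp add: add_pos_pos)
  then have "1 - tilted_mean c i = 2 ^ i / (2 ^ i + 2 powr c)"
    by (simp add: tilted_mean_def field_simps)
  also have "\<dots> \<le> 2 ^ i / 2 powr c"
    using pos by (intro divide_left_mono) auto
  finally show ?thesis .
qed

lemma tilted_mean_le_1: "tilted_mean c i \<le> 1"
  by (simp add: tilted_mean_def add_pos_pos)

lemma tilted_mean_summable: "summable (tilted_mean c)"
proof (rule summable_comparison_test')
  show "summable (\<lambda>i. 2 powr c * (1/2) ^ i)"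
    by (intro summable_mult summable_geometric) auto
  show "norm (tilted_mean c i) \<le> 2 powr c * (1/2) ^ i" for i
    using tilted_mean_pos[of c i] tilted_mean_le[of c i] by (simp add: power_divide)
qed

lemma tilted_mean_ge_half:
  assumes "real i \<le> c"
  shows "tilted_mean c i \<ge> 1/2"
proof -
  have "(2::real) ^ i \<le> 2 powr c"
    using assms by (simp flip: powr_realpow)
  then show ?thesis
    by (simp add: tilted_mean_def field_simps add_pos_pos)
qed

text \<open>The sum is cut at m = floor c + 1. Below m the deficits satisfy 1 - p^k <= k(1-p) <= k
  2^(i-c) and add up to at most 2k; from m on, p^k <= p <= 2^(c-i) adds up to at most 2. The head
  lies between m - 2k and m, with c <= m <= c + 1.\<close>

lemma suminf_tilted_mean_power_bounds:
  fixes k :: nat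
  assumes c: "c \<ge> 0" and k: "k \<in> {1, 2}"
  shows "(\<Sum>i. tilted_mean c i ^ k) \<ge> c - 2 * k" "(\<Sum>i. tilted_mean c i ^ k) \<le> c + 3"
proof -
  define m where "m = nat \<lfloor>c\<rfloor> + 1"
  have m: "c \<le> real m" "real m \<le> c + 1"
    using c unfolding m_def by linarith+
  let ?p = "tilted_mean c"
  have le: "?p i ^ k \<le> ?p i" for i
    using power_decreasing[of 1 k "?p i"] tilted_mean_pos[of c i] tilted_mean_le_1[of c i] k by auto
  have summ: "summable (\<lambda>i. ?p i ^ k)"
    by (rule summable_comparison_test'[OF tilted_mean_summable])
       (use le less_imp_le[OF tilted_mean_pos] in auto)
  have split: "(\<Sum>i. ?p i ^ k) = (\<Sum>i. ?p (i + m) ^ k) + (\<Sum>i<m. ?p i ^ k)"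
    by (rule suminf_split_initial_segment[OF summ])
  have "(\<Sum>i<m. 1 - ?p i ^ k) \<le> (\<Sum>i<m. k * (2 ^ i / 2 powr c))"
  proof (intro sum_mono)
    fix i
    have "1 - ?p i ^ k \<le> k * (1 - ?p i)"
      using k zero_le_power2[of "1 - ?p i"] by (auto simp: power2_eq_square algebra_simps)
    also have "\<dots> \<le> k * (2 ^ i / 2 powr c)"
      by (intro mult_left_mono one_minus_tilted_mean_le) auto
    finally show "1 - ?p i ^ k \<le> k * (2 ^ i / 2 powr c)" .
  qed
  also have "\<dots> = k * ((2 ^ m - 1) / 2 powr c)"
    using geometric_sum[of "2::real" m] by (simp flip: sum_distrib_left sum_divide_distrib)
  also have "\<dots> \<le> real k * 2"
  proof (intro mult_left_mono)
    have "(2::real) ^ m \<le> 2 powr (c + 1)"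
      using m by (simp flip: powr_realpow)
    then show "(2 ^ m - 1) / 2 powr c \<le> (2::real)"
      by (simp add: powr_add field_simps)
  qed auto
  finally have head: "(\<Sum>i<m. ?p i ^ k) \<ge> real m - 2 * real k"
    by (simp add: sum_subtractf)
  have head2: "(\<Sum>i<m. ?p i ^ k) \<le> m"
    using sum_mono[of "{..<m}" "\<lambda>i. ?p i ^ k" "\<lambda>_. 1"] tilted_mean_pos[of c] tilted_mean_le_1[of c]
    by (auto simp: power_le_one less_imp_le)
  have "(\<Sum>i. ?p (i + m) ^ k) \<le> (\<Sum>i. 2 powr c / 2 ^ m * (1/2) ^ i)"
  proof (intro suminf_le summable_mult summable_geometric)
    show "?p (i + m) ^ k \<le> 2 powr c / 2 ^ m * (1/2) ^ i" for i
      using order.trans[OF le[of "i + m"] tilted_mean_le[of c "i + m"]]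
      by (simp add: power_add power_one_over mult.commute)
    show "summable (\<lambda>i. ?p (i + m) ^ k)"
      using summable_ignore_initial_segment[OF summ] .
  qed auto
  also have "\<dots> = 2 powr c / 2 ^ m * 2"
    by (subst suminf_mult) (auto intro!: summable_geometric simp: suminf_geometric)
  also have "\<dots> \<le> 2"
    using m by (simp flip: powr_realpow add: divide_le_eq)
  finally have tail: "(\<Sum>i. ?p (i + m) ^ k) \<le> 2" .
  have tail2: "(\<Sum>i. ?p (i + m) ^ k) \<ge> 0"
    using summable_ignore_initial_segment[OF summ] tilted_mean_pos[of c] by (intro suminf_nonneg) (auto simp: less_imp_le)
  show "(\<Sum>i. ?p i ^ k) \<ge> c - 2 * k" "(\<Sum>i. ?p i ^ k) \<le> c + 3"
    unfolding split using head head2 tail tail2 m by linarith+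
qed

section \<open>Assembling the asymptotic formula\<close>

context exponential_sequence
begin

text \<open>The leading weight 1 in \<open>q\<close> accounts for the factor \<open>1 / (1 - it)\<close>.\<close>

lemma prob_Yinf_eq_integral:
  assumes c: "c \<ge> 1"
  defines "q \<equiv> case_nat 1 (tilted_mean c)"
  shows "measure M {\<omega> \<in> space M. Yinf W \<omega> \<le> c / 2 powr c} =
     (LINT \<omega>|M. exp (- (2 powr c) * Yinf W \<omega>)) * exp c / (2 * pi) *
       (LBINT t. exp (- cf_log_modulus q t) * cos (cf_argument q t - t * c))"
proof -
  define s where "s = 2 powr c"
  have s: "s > 0" by (simp add: s_def)
  define L where "L = (LINT \<omega>|M. exp (- s * Yinf W \<omega>))"
  have L: "L > 0" unfolding L_def using s by (intro Laplace_Yinf_pos) simp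
  interpret T: real_distribution "tilted s"
    using s by (intro real_distribution_tilted) simp
  let ?p = "tilted_mean c"
  have p: "0 \<le> ?p i" "?p i \<le> 1" for i
    using tilted_mean_pos[of c i] tilted_mean_le_1[of c i] by auto
  have q: "0 \<le> q i" "q i \<le> 1" for i
    using p by (auto simp: q_def split: nat.split)
  have q_summable: "summable q"
    by (subst summable_Suc_iff[symmetric]) (simp add: q_def tilted_mean_summable)
  have char_lim: "(\<lambda>n. \<Prod>i<n. 1 / (1 - \<i> * complex_of_real (t * ?p i))) \<longlonglongrightarrow> char (tilted s) t" for t
    using char_tilted[OF s, of t] by (simp add: tilted_mean_def s_def)
  have char_p: "char (tilted s) t = exp (of_real (- cf_log_modulus ?p t) + \<i> * cf_argument ?p t)" for t
    using prod_inverse_tendsto[OF p tilted_mean_summable] char_lim LIMSEQ_unique by blast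
  have char_q: "char (tilted s) t / (1 - \<i> * t) = exp (of_real (- cf_log_modulus q t) + \<i> * cf_argument q t)" for t
  proof (rule LIMSEQ_unique)
    have "(\<lambda>n. (\<Prod>i<n. 1 / (1 - \<i> * complex_of_real (t * ?p i))) / (1 - \<i> * t)) \<longlonglongrightarrow> char (tilted s) t / (1 - \<i> * t)"
      by (intro tendsto_divide char_lim tendsto_const) (auto simp: complex_eq_iff)
    also have "(\<lambda>n. (\<Prod>i<n. 1 / (1 - \<i> * complex_of_real (t * ?p i))) / (1 - \<i> * t)) =
        (\<lambda>n. \<Prod>i<Suc n. 1 / (1 - \<i> * complex_of_real (t * q i)))"
      unfolding prod.lessThan_Suc_shift by (simp add: q_def)
    finally show "(\<lambda>n. \<Prod>i<n. 1 / (1 - \<i> * complex_of_real (t * q i))) \<longlonglongrightarrow> char (tilted s) t / (1 - \<i> * t)"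
      by (rule filterlim_sequentially_Suc[THEN iffD1])
    show "(\<lambda>n. \<Prod>i<n. 1 / (1 - \<i> * complex_of_real (t * q i))) \<longlonglongrightarrow> exp (of_real (- cf_log_modulus q t) + \<i> * cf_argument q t)"
      by (rule prod_inverse_tendsto[OF q q_summable])
  qed
  have int: "complex_integrable lborel (char (tilted s))"
  proof (rule Bochner_Integration.integrable_bound)
    show "integrable lborel (\<lambda>t::real. 1 / (1 + (t / 2)\<^sup>2))"
      by (rule integrable.intros[OF has_bochner_integral_cauchy]) simp
    have "norm (char (tilted s) t) \<le> norm (1 / (1 + (t / 2)\<^sup>2))" for t
    proof -
      have pos: "1 + t\<^sup>2 / 4 > 0"
        by (simp add: add_pos_nonneg)
      \<comment> \<open>Because c >= 1, the means with index 0 and 1 are at least 1/2; two such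
        factors already give the integrable decay 1 / (1 + t^2/4).\<close>
      have "real 2 * ln (1 + t\<^sup>2 / 4) / 2 \<le> cf_log_modulus ?p t"
      proof (rule cf_log_modulus_ge[OF p tilted_mean_summable])
        show "?p i \<ge> 1/2" if "i < 2" for i
          using that c by (intro tilted_mean_ge_half) auto
      qed
      then have "exp (- cf_log_modulus ?p t) \<le> exp (- ln (1 + t\<^sup>2 / 4))"
        by simp
      also have "\<dots> = 1 / (1 + (t / 2)\<^sup>2)"
        using pos by (simp add: exp_minus inverse_eq_divide power_divide)
      finally show ?thesis
        unfolding char_p by simp
    qed
    then show "AE t in lborel. norm (char (tilted s) t) \<le> norm (1 / (1 + (t / 2)\<^sup>2))"
      by simp
  qed auto
  have int2: "complex_integrable lborel (\<lambda>t. iexp (-(t * c)) * char (tilted s) t / (1 - \<i> * t))"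
  proof (rule Bochner_Integration.integrable_bound[OF int])
    have "norm (1 - \<i> * complex_of_real t) \<ge> 1" for t
      using complex_Re_le_cmod[of "1 - \<i> * complex_of_real t"] by simp
    then show "AE t in lborel. norm (iexp (-(t * c)) * char (tilted s) t / (1 - \<i> * t)) \<le> norm (char (tilted s) t)"
      by (intro AE_I2) (auto simp: norm_mult norm_divide divide_le_eq mult_left_le_one_le mult_le_cancel_left1)
  qed measurable
  have "exp (- c) * measure M {\<omega> \<in> space M. s * Yinf W \<omega> \<le> c} / L = Re (1 / (2 * pi) * (CLBINT t. iexp (-(t * c)) * char (tilted s) t / (1 - \<i> * t)))"
    unfolding exp_convolution_tilted[OF s, folded L_def, symmetric] T.exp_convolution_inversion[OF int, symmetric] by simp
  also have "\<dots> = 1 / (2 * pi) * (LBINT t. Re (iexp (-(t * c)) * char (tilted s) t / (1 - \<i> * t)))"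
    using integral_Re[OF int2] by simp
  also have "(\<lambda>t::real. Re (iexp (-(t * c)) * char (tilted s) t / (1 - \<i> * t)))
      = (\<lambda>t. exp (- cf_log_modulus q t) * cos (cf_argument q t - t * c))"
    unfolding times_divide_eq_right[symmetric] char_q mult_exp_exp by (simp add: Re_exp)
  also have "{\<omega> \<in> space M. s * Yinf W \<omega> \<le> c} = {\<omega> \<in> space M. Yinf W \<omega> \<le> c / 2 powr c}"
    by (auto simp: s_def field_simps)
  finally show ?thesis
    using L by (simp add: L_def s_def exp_minus field_simps)
qed

lemma prob_Yinf_approx:
  assumes c: "c \<ge> 8"
  shows "\<exists>e. \<bar>e\<bar> \<le> 72448 * pi / c \<and> measure M {\<omega> \<in> space M. Yinf W \<omega> \<le> c / 2 powr c} =
     (LINT \<omega>|M. exp (- (2 powr c) * Yinf W \<omega>)) * exp c / sqrt (2 * pi * c) * (1 + e)"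
proof -
  let ?p = "tilted_mean c"
  define q where "q = case_nat 1 ?p"
  define J where "J = (LBINT t. exp (- cf_log_modulus q t) * cos (cf_argument q t - t * c))"
  have p: "0 \<le> ?p i" "?p i \<le> 1" for i
    using tilted_mean_pos[of c i] tilted_mean_le_1[of c i] by auto
  have q: "0 \<le> q i" "q i \<le> 1" for i
    using p by (auto simp: q_def split: nat.split)
  have q_summable: "summable q"
    by (subst summable_Suc_iff[symmetric]) (simp add: q_def tilted_mean_summable)
  have sum: "(\<Sum>i. q i ^ k) = 1 + (\<Sum>i. ?p i ^ k)" if "k \<ge> 1" for k
    using suminf_split_head[OF weight_power_summable[OF q q_summable that]] by (simp add: q_def)
  have "\<bar>J - sqrt (2 * pi / c)\<bar> \<le> 72448 * pi / c * sqrt (2 * pi / c)"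
    unfolding J_def
  proof (rule saddle_integral_approx[OF q q_summable c])
    \<comment> \<open>The number of weights that are at least 1/2 is taken as floor c + 1: the
      leading 1 and the means of index below floor c.\<close>
    show "c \<le> real (nat \<lfloor>c\<rfloor> + 1)"
      using c by linarith
    show "1 / 2 \<le> q i" if "i < nat \<lfloor>c\<rfloor> + 1" for i
    proof (cases i)
      case (Suc j)
      then have "real j \<le> c"
        using that c by linarith
      then show ?thesis
        using tilted_mean_ge_half[of j c] by (simp add: q_def Suc)
    qed (simp add: q_def)
    show "\<bar>suminf q - c\<bar> \<le> 4"
      using sum[of 1] suminf_tilted_mean_power_bounds[of c 1] c by simp
    show "\<bar>(\<Sum>i. (q i)\<^sup>2) - c\<bar> \<le> 6"
      using sum[of 2] suminf_tilted_mean_power_bounds[of c 2] c by simp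
  qed
  moreover have pos: "sqrt (2 * pi / c) > 0"
    using c by simp
  moreover have "J / sqrt (2 * pi / c) - 1 = (J - sqrt (2 * pi / c)) / sqrt (2 * pi / c)"
    using c by (simp add: diff_divide_distrib)
  ultimately have "\<bar>J / sqrt (2 * pi / c) - 1\<bar> \<le> 72448 * pi / c"
    by (simp only: abs_divide abs_of_pos pos_divide_le_eq)
  moreover have "1 / (2 * pi) * J = 1 / sqrt (2 * pi * c) * (1 + (J / sqrt (2 * pi / c) - 1))"
  proof -
    \<comment> \<open>This splits the inversion constant 2 pi into the prefactor sqrt (2 pi c) and
      the Gaussian integral sqrt (2 pi / c).\<close>
    have "sqrt ((2 * pi * c) * (2 * pi / c)) = 2 * pi"
      using c by (intro real_sqrt_unique) (auto simp: power2_eq_square)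
    then have "sqrt (2 * pi * c) * sqrt (2 * pi / c) = 2 * pi"
      by (simp only: real_sqrt_mult)
    then show ?thesis
      using c by (simp add: divide_simps)
  qed
  moreover have "measure M {\<omega> \<in> space M. Yinf W \<omega> \<le> c / 2 powr c} =
      (LINT \<omega>|M. exp (- (2 powr c) * Yinf W \<omega>)) * exp c * (1 / (2 * pi) * J)"
    using prob_Yinf_eq_integral[of c] c unfolding q_def[symmetric] J_def[symmetric] by simp
  ultimately show ?thesis
    by (intro exI[of _ "J / sqrt (2 * pi / c) - 1"]) simp
qed

text \<open>The theta product is the Laplace product times the limit of \<open>B\<close>. Since 1 +
  x <= e^x and the numbers 1/(2^j s), j >= 1, sum to 1/s, \<open>B\<close> stays between e^(-1/s)
  and 1.\<close>

lemma Laplace_vs_theta: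
  assumes s: "s > 0"
  shows "NN\<^sup>2 * (Re (PP (of_real s)) / s) \<le> (LINT \<omega>|M. exp (- s * Yinf W \<omega>))"
    and "(LINT \<omega>|M. exp (- s * Yinf W \<omega>)) \<le> NN\<^sup>2 * (Re (PP (of_real s)) / s) * exp (1 / s)"
proof -
  define L where "L = (LINT \<omega>|M. exp (- s * Yinf W \<omega>))"
  define A B where "A n = (\<Prod>j\<le>n. 1 / (1 + s / 2 ^ j))" and "B n = (\<Prod>j<n. 1 / (1 + 1 / (2 ^ (j+1) * s)))" for n
  have A_lim: "A \<longlonglongrightarrow> L"
    unfolding A_def L_def using real_Laplace_transform_tendsto[of s] s
    by (subst lessThan_Suc_atMost[symmetric], subst filterlim_sequentially_Suc) simp
  have AB_lim: "(\<lambda>n. A n * B n) \<longlonglongrightarrow> NN\<^sup>2 * (Re (PP (of_real s)) / s)"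
    unfolding A_def B_def by (rule theta_product_tendsto[OF s])
  have A_nonneg: "A n \<ge> 0" for n
    unfolding A_def using s by (intro prod_nonneg) (auto intro: add_nonneg_nonneg)
  have B_le: "B n \<le> 1" for n
    unfolding B_def using s by (intro prod_le_1) (auto simp: add_pos_pos intro: add_nonneg_nonneg)
  have B_ge: "exp (- (1 / s)) \<le> B n" for n
  proof -
    have "(\<Sum>j<n. 1 / (2 ^ (j+1) * s)) = (1 - (1/2) ^ n) / s"
      using s by (induction n) (auto simp: field_simps)
    also have "\<dots> \<le> 1 / s"
      using s by (intro divide_right_mono) auto
    finally have "exp (- (1 / s)) \<le> exp (\<Sum>j<n. - (1 / (2 ^ (j+1) * s)))"
      by (simp add: sum_negf)
    also have "\<dots> = (\<Prod>j<n. exp (- (1 / (2 ^ (j+1) * s))))"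
      by (rule exp_sum) simp
    also have "\<dots> \<le> B n"
      unfolding B_def
    proof (intro prod_mono conjI)
      fix j
      have "1 + 1 / (2 ^ (j+1) * s) > 0"
        using s by (simp add: add_pos_pos)
      then show "exp (- (1 / (2 ^ (j+1) * s))) \<le> 1 / (1 + 1 / (2 ^ (j+1) * s))"
        unfolding exp_minus inverse_eq_divide by (intro divide_left_mono exp_ge_add_one_self) auto
    qed simp
    finally show ?thesis .
  qed
  show "NN\<^sup>2 * (Re (PP (of_real s)) / s) \<le> L"
    by (rule LIMSEQ_le[OF AB_lim A_lim]) (use mult_left_le[OF B_le A_nonneg] in auto)
  have "(\<lambda>n. A n * exp (- (1 / s))) \<longlonglongrightarrow> L * exp (- (1 / s))"
    by (intro tendsto_intros A_lim)
  then have "L * exp (- (1 / s)) \<le> NN\<^sup>2 * (Re (PP (of_real s)) / s)"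
    by (rule LIMSEQ_le[OF _ AB_lim]) (use mult_left_mono[OF B_ge A_nonneg] in auto)
  then show "L \<le> NN\<^sup>2 * (Re (PP (of_real s)) / s) * exp (1 / s)"
    by (simp add: exp_minus field_simps)
qed

text \<open>A crude bound from 1 + x <= e^x, sufficient to keep the main term away from 0 for
  bounded c.\<close>

lemma Laplace_Yinf_ge:
  assumes s: "s > 0"
  shows "(LINT \<omega>|M. exp (- s * Yinf W \<omega>)) \<ge> exp (- (2 * s))"
proof (rule LIMSEQ_le_const[OF real_Laplace_transform_tendsto])
  show "\<exists>N. \<forall>n\<ge>N. exp (- (2 * s)) \<le> (\<Prod>i<n. 1 / (1 + s / 2 ^ i))"
  proof (intro exI allI impI)
    fix n :: nat
    have "(\<Sum>j<n. s / 2 ^ j) = 2 * s * (1 - (1/2) ^ n)"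
      by (induction n) (simp_all add: algebra_simps power_one_over)
    also have "\<dots> \<le> 2 * s"
      using s by (intro mult_left_le) auto
    finally have "exp (- (2 * s)) \<le> exp (\<Sum>j<n. - (s / 2 ^ j))"
      by (simp add: sum_negf)
    also have "\<dots> = (\<Prod>j<n. exp (- (s / 2 ^ j)))"
      by (rule exp_sum) simp
    also have "\<dots> \<le> (\<Prod>j<n. 1 / (1 + s / 2 ^ j))"
    proof (intro prod_mono conjI)
      fix j
      have "1 + s / 2 ^ j > 0"
        using s by (simp add: add_pos_pos)
      then show "exp (- (s / 2 ^ j)) \<le> 1 / (1 + s / 2 ^ j)"
        unfolding exp_minus inverse_eq_divide by (intro divide_left_mono exp_ge_add_one_self) auto
    qed simp
    finally show "exp (- (2 * s)) \<le> (\<Prod>i<n. 1 / (1 + s / 2 ^ i))" .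
  qed
qed (use s in auto)

text \<open>For c >= 8 the saddle point estimate is combined with the theta comparison. On 1 <= c <
  8 the main term is bounded below and the probability is at most 1, so a large enough constant
  absorbs the relative error.\<close>

lemma prob_Yinf_relative_error:
  assumes c: "c \<ge> 1"
  shows "\<exists>e. \<bar>e\<bar> \<le> (144896 * pi + 2 + 8 * (1 + sqrt (16 * pi) / exp (- 513))) / c \<and>
     measure M {\<omega> \<in> space M. Yinf W \<omega> \<le> c / 2 powr c} =
       NN\<^sup>2 / sqrt (2 * pi * c) * exp c * 2 powr (- c * (c + 1) / 2) * QQ c * (1 + e)"
proof -
  define s where "s = 2 powr c"
  have s: "s > 0" "s \<ge> c + 1"
    using powr_Bernoulli[of 1 c] c by (simp_all add: s_def)
  define L where "L = (LINT \<omega>|M. exp (- s * Yinf W \<omega>))"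
  define T where "T = NN\<^sup>2 * (Re (PP (of_real s)) / s)"
  define P where "P = measure M {\<omega> \<in> space M. Yinf W \<omega> \<le> c / 2 powr c}"
  define m where "m = T * exp c / sqrt (2 * pi * c)"
  have L: "L > 0" unfolding L_def using s by (intro Laplace_Yinf_pos) simp
  have TL: "T \<le> L" "L \<le> T * exp (1 / s)"
    unfolding T_def L_def using Laplace_vs_theta[OF s(1)] by auto
  \<comment> \<open>Positivity of the theta series is read off from 0 < L <= T e^(1/s).\<close>
  have T: "T > 0"
    using less_le_trans[OF L TL(2)] by (simp add: zero_less_mult_iff)
  have m: "m > 0"
    using T c by (simp add: m_def)
  \<comment> \<open>The exponents add up to -c, so the power of 2 and the normalisation of
    \<open>QQ\<close> combine to the factor 1/s in \<open>T\<close>.\<close>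
  have "2 powr (- c * (c + 1) / 2) * 2 powr (c * (c - 1) / 2) = 1 / s"
    unfolding powr_add[symmetric] s_def powr_minus_divide[symmetric]
    by (rule arg_cong[where f = "(powr) 2"]) (simp add: field_simps)
  then have "2 powr (- c * (c + 1) / 2) * QQ c = Re (PP (of_real s)) / s"
    by (simp add: QQ_def s_def mult.assoc[symmetric])
  moreover have "NN\<^sup>2 / sqrt (2 * pi * c) * exp c * 2 powr (- c * (c + 1) / 2) * QQ c =
      NN\<^sup>2 * (2 powr (- c * (c + 1) / 2) * QQ c) * exp c / sqrt (2 * pi * c)"
    by simp
  ultimately have m_eq: "NN\<^sup>2 / sqrt (2 * pi * c) * exp c * 2 powr (- c * (c + 1) / 2) * QQ c = m"
    by (simp only: m_def T_def)
  \<comment> \<open>A lower bound for \<open>T\<close> when c < 8: there s <= 256 and 1/s <= 1, so T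
    >= L e^(-1/s) >= e^(-2s - 1/s) >= e^(-513).\<close>
  define E where "E = exp (- 513 :: real)"
  define K where "K = sqrt (16 * pi) / E"
  have E: "E > 0" and K: "K \<ge> 0"
    by (simp_all add: E_def K_def)
  have "\<bar>P / m - 1\<bar> \<le> (144896 * pi + 2 + 8 * (1 + K)) / c"
  proof (cases "c \<ge> 8")
    case True
    obtain e where e: "\<bar>e\<bar> \<le> 72448 * pi / c" and P: "P = L * exp c / sqrt (2 * pi * c) * (1 + e)"
      using prob_Yinf_approx[OF True] unfolding P_def L_def s_def by blast
    define d where "d = L / T - 1"
    have "exp (1 / s) \<le> 1 + 1 / s + (1 / s)\<^sup>2"
      using s c by (intro exp_bound) (auto simp: field_simps)
    also have "\<dots> \<le> 1 + 2 / s"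
    proof -
      have "(1 / s)\<^sup>2 \<le> 1 / s"
        using s c power_decreasing[of 1 2 "1 / s"] by simp
      then show ?thesis by simp
    qed
    also have "\<dots> \<le> 1 + 2 / c"
      using s c by (simp add: frac_le)
    finally have "L \<le> T * (1 + 2 / c)"
      using TL(2) mult_left_mono[of "exp (1 / s)" "1 + 2 / c" T] T by linarith
    then have d: "0 \<le> d" "d \<le> 2 / c"
      using TL(1) T by (simp_all add: d_def field_simps)
    \<comment> \<open>The theta comparison contributes d <= 2/c and the saddle point e. As d <= 1,
      the cross term costs one more |e|, which doubles 72448 to 144896.\<close>
    have "P / m - 1 = (1 + d) * (1 + e) - 1"
      using T c unfolding P m_def d_def by simp
    also have "\<dots> = d + e + d * e"
      by (simp add: algebra_simps)
    finally have "\<bar>P / m - 1\<bar> \<le> d + \<bar>e\<bar> + \<bar>d * e\<bar>"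
      using d by linarith
    moreover have "\<bar>d * e\<bar> = d * \<bar>e\<bar>"
      using d by (simp add: abs_mult)
    moreover have "2 / c \<le> 1"
      using True by simp
    then have "d * \<bar>e\<bar> \<le> 1 * \<bar>e\<bar>"
      using d by (intro mult_right_mono) auto
    ultimately have "\<bar>P / m - 1\<bar> \<le> 2 / c + 2 * (72448 * pi / c)"
      using d e by linarith
    also have "\<dots> = (144896 * pi + 2) / c"
      by (simp add: add_divide_distrib)
    also have "\<dots> \<le> (144896 * pi + 2 + 8 * (1 + K)) / c"
      using c K by (intro divide_right_mono) auto
    finally show ?thesis .
  next
    case False
    have "s \<le> 2 powr 8"
      unfolding s_def using False by (intro powr_mono) auto
    then have s256: "s \<le> 256" by simp
    have "1 / s \<le> 1"
      using s c by simp
    then have "E \<le> exp (- (2 * s)) * exp (- (1 / s))"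
      unfolding E_def mult_exp_exp exp_le_cancel_iff using s256 by linarith
    also have "\<dots> \<le> L * exp (- (1 / s))"
      unfolding L_def by (intro mult_right_mono Laplace_Yinf_ge s) auto
    also have "\<dots> \<le> T"
      using TL(2) by (simp add: exp_minus field_simps)
    finally have T_ge: "E \<le> T" .
    have "1 / m = sqrt (2 * pi * c) / (T * exp c)"
      by (simp add: m_def)
    also have "\<dots> \<le> sqrt (16 * pi) / (E * 1)"
    proof (intro frac_le mult_mono)
      show "sqrt (2 * pi * c) \<le> sqrt (16 * pi)"
        using False by (intro real_sqrt_le_mono) simp
    qed (use c E T_ge in auto)
    finally have m_le: "1 / m \<le> K"
      by (simp add: K_def)
    have "0 \<le> P" "P \<le> 1"
      by (simp_all add: P_def)
    then have "0 \<le> P / m" "P / m \<le> 1 / m"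
      using m by (simp_all add: divide_right_mono)
    then have "\<bar>P / m - 1\<bar> \<le> 1 + K"
      using m_le K by linarith
    \<comment> \<open>A bounded error is O(1/c) here because c < 8.\<close>
    also have "\<dots> \<le> 8 * (1 + K) / c"
    proof -
      have "(1 + K) * c \<le> (1 + K) * 8"
        using False K by (intro mult_left_mono) auto
      then show ?thesis
        using c by (simp add: le_divide_eq mult.commute)
    qed
    also have "\<dots> \<le> (144896 * pi + 2 + 8 * (1 + K)) / c"
      using c by (intro divide_right_mono) auto
    finally show ?thesis .
  qed
  moreover have "P = m * (1 + (P / m - 1))"
    using m by simp
  ultimately show ?thesis
    unfolding m_eq K_def E_def P_def[symmetric] by blast
qed

end

theorem theorem12:
  shows "\<exists>C::real. \<forall>(M::'a measure) (W::nat \<Rightarrow> 'a \<Rightarrow> real).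
     (prob_space M \<and> prob_space.indep_vars M (\<lambda>_. borel) W {1..}
      \<and> (\<forall>i\<ge>1. distributed M lborel (W i) (exponential_density 1)))
     \<longrightarrow> (\<forall>c::real. c \<ge> 1 \<longrightarrow>
           (\<exists>e::real. \<bar>e\<bar> \<le> C / c \<and>
              measure M {\<omega> \<in> space M. Yinf W \<omega> \<le> c / 2 powr c}
              = NN\<^sup>2 / sqrt (2 * pi * c) * exp c * 2 powr (- c * (c + 1) / 2) * QQ c * (1 + e)))"
proof (rule exI, intro allI impI)
  fix M :: "'a measure" and W :: "nat \<Rightarrow> 'a \<Rightarrow> real" and c :: real
  assume *: "prob_space M \<and> prob_space.indep_vars M (\<lambda>_. borel) W {1..}
      \<and> (\<forall>i\<ge>1. distributed M lborel (W i) (exponential_density 1))" and c: "c \<ge> 1"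
  interpret exponential_sequence M W
    by (intro exponential_sequence.intro exponential_sequence_axioms.intro; use * in blast)
  \<comment> \<open>This goal instantiates the constant left open by \<open>exI\<close>; it is a
    closed numerical expression, independent of \<open>M\<close>, \<open>W\<close> and
    \<open>c\<close>.\<close>
  show "\<exists>e::real. \<bar>e\<bar> \<le> (144896 * pi + 2 + 8 * (1 + sqrt (16 * pi) / exp (- 513))) / c \<and>
              measure M {\<omega> \<in> space M. Yinf W \<omega> \<le> c / 2 powr c}
              = NN\<^sup>2 / sqrt (2 * pi * c) * exp c * 2 powr (- c * (c + 1) / 2) * QQ c * (1 + e)"
    by (rule prob_Yinf_relative_error[OF c])
qed

end
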